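(* Let $\alpha$ be a positive number, let $\nu_\alpha$ be the free Gamma distribution with parameter $\alpha$, and let $\mu_1$ be the classical Gamma distribution with parameter $1$. Then: (i) $\mathcal{C}_{\nu_\alpha}(\frac1z)=\alpha G_{\mu_1}(z)$ for all $z$ in $\mathbb{C}^+$. (ii) $G_{\nu_\alpha}(H_\alpha(z))=\frac1z$ for all $z$ in $\mathcal{G}_\alpha^+$.
   Context: $\mathbb{C}^{\pm}$ denote the open upper/lower half planes. Free Gamma distribution. For $\alpha>0$ let $\mu_\alpha$ be the classical Gamma distribution, $\mu_\alpha(B)=\frac1{\Gamma(\alpha)}\int_{B\cap[0,\infty)}t^{\alpha-1}e^{-t}\,dt$. A probability measure $\mu$ on $\mathbb{R}$ is ($*$-)infinitely divisible iff its characteristic function is $\hat\mu(u)=\exp\big[\mathrm{i}\eta u-\frac12au^2+\int_{\mathbb{R}}(e^{\mathrm{i}ut}-1-\mathrm{i}ut1_{[-1,1]}(t))\,\rho(dt)\big]$ with $\eta\in\mathbb{R}$, $a\ge0$ and $\rho$ a Lévy measure ($\rho(\{0\})=0$, $\int\min\{1,t^2\}\,\rho(dt)<\infty$); $(a,\rho,\eta)$ is unique and called the characteristic triplet of $\mu$. The Cauchy transform of $\mu$ is $G_\mu(z)=\int_{\mathbb{R}}\frac{1}{z-t}\,\mu(dt)$, $z\in\mathbb{C}\setminus\mathrm{supp}(\mu)$. The free cumulant transform is $\mathcal{C}_\mu(z)=zG_\mu^{\langle-1\rangle}(z)-1$, defined for $z\in\mathbb{C}^-$ with $1/z\in\Delta_{\eta,M}=\{w\in\mathbb{C}^+: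 |\mathrm{Re}\,w|<\eta\,\mathrm{Im}\,w,\ \mathrm{Im}\,w>M\}$ for suitable $\eta,M>0$, where the right inverse $G_\mu^{\langle-1\rangle}$ of $G_\mu$ is well-defined. $\mu$ is infinitely divisible with respect to free convolution $\boxplus$ iff $\mathcal{C}_\mu(z)=\eta z+az^2+\int_{\mathbb{R}}\big(\frac{1}{1-tz}-1-tz1_{[-1,1]}(t)\big)\,\rho(dt)$ for some $a\ge0$, $\eta\in\mathbb{R}$ and Lévy measure $\rho$; then $(a,\rho,\eta)$ is unique and called the free characteristic triplet of $\mu$, and $\mathcal{C}_\mu$ extends to an analytic function on all of $\mathbb{C}^-$, still denoted $\mathcal{C}_\mu$. The Bercovici–Pata bijection $\Lambda$ sends the $*$-infinitely divisible law with characteristic triplet $(a,\rho,\eta)$ to the $\boxplus$-infinitely divisible law with free characteristic triplet $(a,\rho,\eta)$. The free Gamma distribution with parameter $\alpha$ is $\nu_\alpha=\Lambda(\mu_\alpha)$. Auxiliary functions. For $z\in\mathbb{C}\setminus[0,\infty)$ put $H_\alpha(z)=z+\alpha zG_{\mu_1}(z)=z+\alpha+\alpha\int_0^\infty\frac{te^{-t}}{z-t}\,dt$ and $F(z)=\int_0^\infty\frac{te^{-t}}{|z-t|^2}\,dt$. $c_\alpha$ is the unique positive number with $F(-c_\alpha)=\frac1\alpha$. $v_\alpha\colon\mathbb{R}\to[0,\infty)$ is given by $v_\alpha(x)=0$ for $x\le-c_\alpha$, and for $x>-c_\alpha$, $v_\alpha(x)$ is the unique $y>0$ with $F(x+\mathrm{i}y)=\frac1\alpha$.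 Finally $\mathcal{G}_\alpha^+=\{x+\mathrm{i}y: x,y\in\mathbb{R},\ y>v_\alpha(x)\}$, which equals $\{z\in\mathbb{C}^+: H_\alpha(z)\in\mathbb{C}^+\}$. *)

theory Defs
  imports "HOL-Probability.Probability" "HOL-Complex_Analysis.Complex_Analysis"
begin

definition gamma_distribution :: "real \<Rightarrow> real measure" where
  "gamma_distribution \<alpha> =
     density lborel (\<lambda>t. ennreal (indicator {0..} t * (t powr (\<alpha> - 1) * exp (- t)) / Gamma \<alpha>))"

definition levy_measure :: "real measure \<Rightarrow> bool" where
  "levy_measure \<rho> \<longleftrightarrow> sets \<rho> = sets borel \<and> emeasure \<rho> {0} = 0 \<and>
     (\<integral>\<^sup>+ t. ennreal (min 1 (t\<^sup>2)) \<partial>\<rho>) < \<infinity>"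

definition characteristic_triplet ::
    "real measure \<Rightarrow> real \<Rightarrow> real measure \<Rightarrow> real \<Rightarrow> bool" where
  "characteristic_triplet \<mu> a \<rho> \<eta> \<longleftrightarrow>
     real_distribution \<mu> \<and> a \<ge> 0 \<and> levy_measure \<rho> \<and>
     (\<forall>u. char \<mu> u = exp (\<i> * of_real (\<eta> * u) - of_real (a * u\<^sup>2 / 2) +
        (\<integral>t. exp (\<i> * of_real (u * t)) - 1 -
              \<i> * of_real (u * t * indicator {-1..1} t) \<partial>\<rho>)))"

definition cauchy_transform :: "real measure \<Rightarrow> complex \<Rightarrow> complex" where
  "cauchy_transform \<mu> z = (\<integral>t. 1 / (z - of_real t) \<partial>\<mu>)"

definition truncated_cone :: "real \<Rightarrow> real \<Rightarrow> complex set" where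
  "truncated_cone \<eta> M = {w. \<bar>Re w\<bar> < \<eta> * Im w \<and> Im w > M}"

text \<open>
  The Cauchy transform need not be injective on the upper half plane, so the equation
  \<open>G (g z) = z\<close> alone does not determine \<open>g\<close>: for the symmetric Bernoulli law on \<open>{-1, 1}\<close>
  there are two analytic solutions with values in the upper half plane. The right inverse used
  in free probability is the analytic branch with \<open>g z \<sim> 1/z\<close> as \<open>z \<rightarrow> 0\<close> nontangentially;
  it is unique on each region where it exists.
\<close>

definition cauchy_right_inverse ::
    "real measure \<Rightarrow> real \<Rightarrow> real \<Rightarrow> (complex \<Rightarrow> complex) \<Rightarrow> bool" where
  "cauchy_right_inverse \<mu> \<eta> M g \<longleftrightarrow>
     g holomorphic_on {z. 1 / z \<in> truncated_cone \<eta> M} \<and>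
     (\<forall>z. 1 / z \<in> truncated_cone \<eta> M \<longrightarrow> Im (g z) > 0 \<and> cauchy_transform \<mu> (g z) = z) \<and>
     ((\<lambda>z. z * g z) \<longlongrightarrow> 1) (at 0 within {z. 1 / z \<in> truncated_cone \<eta> M})"

text \<open>\<open>C\<close> agrees with the free cumulant transform of \<open>\<mu>\<close> on a region where the latter is defined
  through the right inverse.\<close>

definition represents_free_cumulant :: "real measure \<Rightarrow> (complex \<Rightarrow> complex) \<Rightarrow> bool" where
  "represents_free_cumulant \<mu> C \<longleftrightarrow>
     (\<exists>\<eta>>0. \<exists>M>0. \<exists>g. cauchy_right_inverse \<mu> \<eta> M g \<and>
        (\<forall>z. 1 / z \<in> truncated_cone \<eta> M \<longrightarrow> C z = z * g z - 1))"

definition free_characteristic_triplet ::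
    "real measure \<Rightarrow> real \<Rightarrow> real measure \<Rightarrow> real \<Rightarrow> bool" where
  "free_characteristic_triplet \<nu> a \<rho> \<eta> \<longleftrightarrow>
     real_distribution \<nu> \<and> a \<ge> 0 \<and> levy_measure \<rho> \<and>
     represents_free_cumulant \<nu> (\<lambda>z. of_real \<eta> * z + of_real a * z\<^sup>2 +
        (\<integral>t. 1 / (1 - of_real t * z) - 1 - of_real (t * indicator {-1..1} t) * z \<partial>\<rho>))"

text \<open>The free cumulant transform extended analytically to the lower half plane. It is meaningful
  only for measures admitting such an extension, in particular for all freely infinitely divisible
  ones; the extension is unique by the identity theorem.\<close>

definition free_cumulant :: "real measure \<Rightarrow> complex \<Rightarrow> complex" where
  "free_cumulant \<mu> z =
     (THE w. \<exists>C. C holomorphic_on {z. Im z < 0} \<and> represents_free_cumulant \<mu> C \<and> w = C z)"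

text \<open>The graph of the Bercovici--Pata bijection: \<open>bercovici_pata \<mu> \<nu>\<close> means \<open>\<nu> = \<Lambda>(\<mu>)\<close>.\<close>

definition bercovici_pata :: "real measure \<Rightarrow> real measure \<Rightarrow> bool" where
  "bercovici_pata \<mu> \<nu> \<longleftrightarrow>
     (\<exists>a \<rho> \<eta>. characteristic_triplet \<mu> a \<rho> \<eta> \<and> free_characteristic_triplet \<nu> a \<rho> \<eta>)"

definition free_gamma_distribution :: "real \<Rightarrow> real measure \<Rightarrow> bool" where
  "free_gamma_distribution \<alpha> \<nu> \<longleftrightarrow> bercovici_pata (gamma_distribution \<alpha>) \<nu>"

definition H_fun :: "real \<Rightarrow> complex \<Rightarrow> complex" where
  "H_fun \<alpha> z = z + of_real \<alpha> * z * cauchy_transform (gamma_distribution 1) z"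

definition F_fun :: "complex \<Rightarrow> real" where
  "F_fun z = (LBINT t:{0..}. t * exp (- t) / (cmod (z - of_real t))\<^sup>2)"

definition c_const :: "real \<Rightarrow> real" where
  "c_const \<alpha> = (THE c. c > 0 \<and> F_fun (- of_real c) = 1 / \<alpha>)"

definition v_fun :: "real \<Rightarrow> real \<Rightarrow> real" where
  "v_fun \<alpha> x =
     (if x \<le> - c_const \<alpha> then 0 else (THE y. y > 0 \<and> F_fun (Complex x y) = 1 / \<alpha>))"

definition G_plus :: "real \<Rightarrow> complex set" where
  "G_plus \<alpha> = {z. Im z > v_fun \<alpha> (Re z)}"

end

theory Submission
  imports Defs "HOL-Real_Asymp.Real_Asymp"
begin

text \<open>
  The Laplace transform links the classical and the free exponent of a triplet, so the free cumulant
  transform of \<open>\<nu>\<close> can be read off from the characteristic function of \<open>\<mu>\<^sub>\<alpha>\<close>. Let \<open>\<psi>\<close> be the exponent in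
  the Levy--Khintchine formula of a triplet \<open>(a, \<rho>, \<eta>)\<close>, and let \<open>C\<close> be the free exponent of the
  same triplet. Since \<open>p / (p + it) = p \<integral> exp (- p s) exp (- i s t) ds\<close> over the positive half-line,
  Fubini's theorem gives, for \<open>Re p > 0\<close>,
  \<open>C (1 / (i p)) = p \<integral> exp (- p s) \<psi> (- s) ds\<close> (\<open>free_levy_exponent_laplace\<close>). So \<open>C\<close> depends on
  \<open>\<psi>\<close> alone, and \<open>\<psi>\<close> is determined by the characteristic function because it is a continuous
  logarithm of it: for \<open>\<mu>\<^sub>\<alpha>\<close> it is \<open>- \<alpha> Ln (1 - i u)\<close> (\<open>levy_exponent_gamma\<close>). The Cauchy transform
  has a similar Laplace representation,
  \<open>G\<^sub>\<mu> (i p) = - i \<integral> exp (- p s) char \<mu> (- s) ds\<close> (\<open>cauchy_transform_laplace_char\<close>), and an integration by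
  parts turns the logarithm into \<open>1 / (1 + i s)\<close>, the characteristic function of \<open>\<mu>\<^sub>1\<close> at \<open>- s\<close>.
  Hence \<open>C (1 / z) = \<alpha> G\<^sub>\<mu>\<^sub>1 (z)\<close> on the upper half-plane (\<open>free_levy_exponent_gamma\<close>).

  Part (i) then needs that a measure has at most one free cumulant transform on the lower half-plane
  (\<open>represents_free_cumulant_unique\<close>). Two right inverses of \<open>G\<^sub>\<nu>\<close> with \<open>z g z\<close> tending to \<open>1\<close>
  agree at \<open>1 / (i x)\<close> for large \<open>x\<close>, since \<open>G\<^sub>\<nu>\<close> is injective near infinity on such values; the identity
  theorem does the rest.

  For part (ii), write \<open>H z = z (1 + \<alpha> G\<^sub>\<mu>\<^sub>1 z)\<close>. At \<open>z = i x\<close> with \<open>x\<close> large, the definition of the free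
  cumulant transform and part (i) say that \<open>H z\<close> is the value of the right inverse at \<open>1 / z\<close>, so \<open>G\<^sub>\<nu> (H z) = 1 / z\<close> there. Because
  \<open>Im (H z) = Im z (1 - \<alpha> F z)\<close>, both sides are holomorphic on the set where \<open>F < 1 / \<alpha>\<close>. This set is
  connected since \<open>F\<close> decreases along vertical lines and every point of large imaginary part belongs
  to it. Finally \<open>\<G>\<^sub>\<alpha>\<^sup>+\<close> lies in this set, once \<open>c\<^sub>\<alpha>\<close> and \<open>v\<^sub>\<alpha>\<close> are known to be well defined
  (\<open>c_const_props\<close>, \<open>v_fun_props\<close>).
\<close>

section \<open>Integration on the half-line and parameter integrals\<close>

lemma set_integral_FTC_Ioi:
  fixes f F :: "real \<Rightarrow> complex"
  assumes F: "\<And>x. x > 0 \<Longrightarrow> (F has_vector_derivative f x) (at x)"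
    and f: "\<And>x. x > 0 \<Longrightarrow> isCont f x"
    and int: "set_integrable lborel {0<..} f"
    and A: "(F \<longlongrightarrow> A) (at_right 0)" and B: "(F \<longlongrightarrow> B) at_top"
  shows "(LBINT x:{0<..}. f x) = B - A"
proof -
  have "(LBINT x=0..\<infinity>. f x) = B - A"
  proof (rule interval_integral_FTC_integrable)
    show "((F \<circ> real_of_ereal) \<longlongrightarrow> A) (at_right 0)"
      using A unfolding zero_ereal_def ereal_tendsto_simps .
    show "((F \<circ> real_of_ereal) \<longlongrightarrow> B) (at_left \<infinity>)"
      using B unfolding ereal_tendsto_simps .
    show "set_integrable lborel (einterval 0 \<infinity>) f"
      using int by (simp add: zero_ereal_def)
  qed (use F f in auto)
  then show ?thesis
    by (simp add: interval_lebesgue_integral_def zero_ereal_def)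
qed

lemma continuous_on_lebesgue_integral:
  fixes f :: "'b::metric_space \<Rightarrow> 'a \<Rightarrow> 'c::{banach, second_countable_topology}"
  assumes meas: "\<And>x. x \<in> S \<Longrightarrow> f x \<in> borel_measurable M"
    and cont: "AE t in M. continuous_on S (\<lambda>x. f x t)"
    and bound: "\<And>x. x \<in> S \<Longrightarrow> AE t in M. norm (f x t) \<le> b t"
    and b: "integrable M b"
  shows "continuous_on S (\<lambda>x. \<integral>t. f x t \<partial>M)"
  unfolding continuous_on_sequentially comp_def
proof safe
  fix X a assume a: "a \<in> S" and X: "\<forall>n. X n \<in> S" "X \<longlonglongrightarrow> a"
  show "(\<lambda>n. \<integral>t. f (X n) t \<partial>M) \<longlonglongrightarrow> (\<integral>t. f a t \<partial>M)"
  proof (rule integral_dominated_convergence[where w = b])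
    show "AE t in M. (\<lambda>n. f (X n) t) \<longlonglongrightarrow> f a t"
      using cont
    proof eventually_elim
      case (elim t)
      then show ?case
        using a X unfolding continuous_on_sequentially comp_def by blast
    qed
  qed (use a X meas bound b in auto)
qed

lemma has_field_derivative_lebesgue_integral:
  fixes f :: "complex \<Rightarrow> 'a \<Rightarrow> complex"
  assumes S: "open S" "convex S" and z: "z \<in> S"
    and int: "\<And>w. w \<in> S \<Longrightarrow> integrable M (f w)"
    and f'meas: "f' z \<in> borel_measurable M"
    and deriv: "\<And>w t. w \<in> S \<Longrightarrow> t \<in> space M \<Longrightarrow> ((\<lambda>w. f w t) has_field_derivative f' w t) (at w)"
    and bound: "\<And>w t. w \<in> S \<Longrightarrow> t \<in> space M \<Longrightarrow> norm (f' w t) \<le> b t"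
    and b: "integrable M b"
  shows "((\<lambda>w. \<integral>t. f w t \<partial>M) has_field_derivative (\<integral>t. f' z t \<partial>M)) (at z)"
proof -
  have "((\<lambda>w. ((\<integral>t. f w t \<partial>M) - (\<integral>t. f z t \<partial>M)) / (w - z)) \<longlongrightarrow> (\<integral>t. f' z t \<partial>M)) (at z within S)"
    unfolding tendsto_at_iff_sequentially comp_def
  proof (intro allI impI)
    fix X assume X: "\<forall>i. X i \<in> S - {z}" "X \<longlonglongrightarrow> z"
    have "(\<lambda>n. \<integral>t. (f (X n) t - f z t) / (X n - z) \<partial>M) \<longlonglongrightarrow> (\<integral>t. f' z t \<partial>M)"
    proof (rule integral_dominated_convergence[where w = b])
      show "(\<lambda>t. (f (X n) t - f z t) / (X n - z)) \<in> borel_measurable M" for n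
        using int[of "X n"] int[OF z] X by (auto dest!: borel_measurable_integrable)
      show "AE t in M. (\<lambda>n. (f (X n) t - f z t) / (X n - z)) \<longlonglongrightarrow> f' z t"
      proof (rule AE_I2)
        fix t assume "t \<in> space M"
        from deriv[OF z this]
        have "((\<lambda>w. (f w t - f z t) / (w - z)) \<longlongrightarrow> f' z t) (at z)"
          by (simp add: has_field_derivative_iff)
        then show "(\<lambda>n. (f (X n) t - f z t) / (X n - z)) \<longlonglongrightarrow> f' z t"
          using X unfolding tendsto_at_iff_sequentially comp_def by auto
      qed
      show "AE t in M. norm ((f (X n) t - f z t) / (X n - z)) \<le> b t" for n
      proof (rule AE_I2)
        fix t assume t: "t \<in> space M"
        have "norm (f (X n) t - f z t) \<le> b t * norm (X n - z)"
          by (rule field_differentiable_bound[where f' = "\<lambda>w. f' w t" and S = S])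
            (use S z t X deriv bound in \<open>auto intro: has_field_derivative_at_within\<close>)
        moreover have "X n \<noteq> z"
          using X by auto
        ultimately show "norm ((f (X n) t - f z t) / (X n - z)) \<le> b t"
          by (simp add: norm_divide divide_le_eq)
      qed
    qed (use f'meas b in auto)
    also have "(\<lambda>n. \<integral>t. (f (X n) t - f z t) / (X n - z) \<partial>M)
        = (\<lambda>n. ((\<integral>t. f (X n) t \<partial>M) - (\<integral>t. f z t \<partial>M)) / (X n - z))"
      using int int[OF z] X by (intro ext) (simp add: Bochner_Integration.integral_diff)
    finally show "(\<lambda>n. ((\<integral>t. f (X n) t \<partial>M) - (\<integral>t. f z t \<partial>M)) / (X n - z)) \<longlonglongrightarrow> (\<integral>t. f' z t \<partial>M)" .
  qed
  then show ?thesis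
    unfolding has_field_derivative_iff at_within_open[OF z S(1)] .
qed

section \<open>The Cauchy transform on the upper half-plane\<close>

lemma abs_Im_le_norm_diff_real: "\<bar>Im z\<bar> \<le> norm (z - of_real t)"
  using abs_Im_le_cmod[of "z - of_real t"] by simp

lemma cauchy_kernel_bound:
  assumes "Im z > 0"
  shows "norm (1 / (z - of_real t)) \<le> 1 / Im z"
proof -
  have "Im z \<le> norm (z - of_real t)"
    using abs_Im_le_norm_diff_real[of z t] assms by simp
  then show ?thesis
    using assms by (auto simp: norm_divide intro!: divide_left_mono mult_pos_pos)
qed

lemma (in real_distribution) integrable_cauchy_kernel:
  assumes "Im z > 0"
  shows "integrable M (\<lambda>t. 1 / (z - of_real t))"
  by (rule integrable_const_bound[of _ "1 / Im z"]) (use cauchy_kernel_bound[OF assms] in auto)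

lemma (in real_distribution) cauchy_transform_holomorphic:
  "cauchy_transform M holomorphic_on {z. Im z > 0}"
proof (rule holomorphic_onI)
  fix z :: complex assume z: "z \<in> {z. Im z > 0}"
  \<comment> \<open>On this half-plane the derivative of the kernel is bounded uniformly in \<open>t\<close>.\<close>
  define S where "S = {w. Im w > Im z / 2}"
  have S: "open S" "convex S" "z \<in> S"
    unfolding S_def using z by (auto simp only: open_halfspace_Im_gt convex_halfspace_Im_gt mem_Collect_eq)
  have "((\<lambda>w. \<integral>t. 1 / (w - of_real t) \<partial>M) has_field_derivative (\<integral>t. - 1 / (z - of_real t)\<^sup>2 \<partial>M)) (at z)"
  proof (rule has_field_derivative_lebesgue_integral[OF S, where b = "\<lambda>_. (2 / Im z)\<^sup>2"])
    fix w t assume w: "w \<in> S"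
    with z have im: "Im w > 0" "Im z / 2 < Im w" by (auto simp: S_def)
    then have ne: "w \<noteq> of_real t" by auto
    show "((\<lambda>w. 1 / (w - of_real t)) has_field_derivative - 1 / (w - of_real t)\<^sup>2) (at w)"
      using ne by (auto intro!: derivative_eq_intros simp: power2_eq_square)
    have "norm (1 / (w - of_real t)) \<le> 2 / Im z"
    proof -
      have "norm (1 / (w - of_real t)) \<le> 1 / Im w"
        by (rule cauchy_kernel_bound) fact
      also have "\<dots> \<le> 2 / Im z"
        using im z by (simp add: field_simps)
      finally show ?thesis .
    qed
    then have "(norm (1 / (w - of_real t)))\<^sup>2 \<le> (2 / Im z)\<^sup>2"
      by (rule power_mono) simp
    then show "norm (- 1 / (w - of_real t)\<^sup>2) \<le> (2 / Im z)\<^sup>2"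
      by (simp add: norm_divide norm_power power_divide)
  next
    fix w assume "w \<in> S"
    then have "Im w > 0" using z by (auto simp: S_def)
    then show "integrable M (\<lambda>t. 1 / (w - of_real t))"
      by (rule integrable_cauchy_kernel)
  qed auto
  then show "cauchy_transform M field_differentiable at z within {z. Im z > 0}"
    unfolding cauchy_transform_def[abs_def] field_differentiable_def
    by (blast intro: has_field_derivative_at_within)
qed

section \<open>Laplace transform and characteristic function of the Gamma distribution\<close>

definition gamma_laplace :: "real \<Rightarrow> complex \<Rightarrow> complex" where
  "gamma_laplace \<alpha> s = (LBINT t:{0<..}. of_real (t powr (\<alpha> - 1)) * exp (- (s * of_real t)))"

lemma gamma_laplace_integrable:
  assumes "\<alpha> > 0" "Re s > 0"
  shows "set_integrable lborel {0<..} (\<lambda>t. of_real (t powr (\<alpha> - 1)) * exp (- (s * of_real t)) :: complex)"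
proof -
  let ?g = "\<lambda>t. complex_of_real t powr (of_real \<alpha> - 1) / of_real (exp (Re s * t))"
  have "?g absolutely_integrable_on {0<..}"
    using assms by (intro absolutely_integrable_Gamma_integral) auto
  then have "integrable lebesgue (\<lambda>t. indicator {0<..} t *\<^sub>R (t powr (\<alpha> - 1) * exp (- (Re s * t))))"
    unfolding set_integrable_def
    by (rule Bochner_Integration.integrable_bound)
      (auto simp: norm_divide norm_mult norm_powr_real_powr exp_minus divide_simps
         intro!: measurable_completion split: split_indicator)
  then have "integrable lborel (\<lambda>t. indicator {0<..} t *\<^sub>R (t powr (\<alpha> - 1) * exp (- (Re s * t))))"
    by (subst (asm) integrable_completion) auto
  then show ?thesis
    unfolding set_integrable_def
    by (rule Bochner_Integration.integrable_bound) (auto simp: norm_mult split: split_indicator)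
qed

lemma gamma_laplace_deriv:
  assumes "\<alpha> > 0" "Re s > 0"
  shows "(gamma_laplace \<alpha> has_field_derivative - gamma_laplace (\<alpha> + 1) s) (at s)"
proof -
  define S where "S = {w. Re w > Re s / 2}"
  have S: "open S" "convex S" "s \<in> S"
    unfolding S_def using assms by (auto simp only: open_halfspace_Re_gt convex_halfspace_Re_gt mem_Collect_eq)
  let ?f = "\<lambda>w t. indicator {0<..} t *\<^sub>R (complex_of_real (t powr (\<alpha> - 1)) * exp (- (w * of_real t)))"
  let ?f' = "\<lambda>w t. indicator {0<..} t *\<^sub>R - (complex_of_real (t powr (\<alpha> + 1 - 1)) * exp (- (w * of_real t)))"
  let ?b = "\<lambda>t. norm (indicator {0<..} t *\<^sub>R (complex_of_real (t powr (\<alpha> + 1 - 1)) * exp (- (of_real (Re s / 2) * of_real t))))"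
  have powr: "t * t powr (\<alpha> - 1) = t powr \<alpha>" if "t > 0" for t :: real
    using that by (simp add: powr_diff)
  have "((\<lambda>w. \<integral>t. ?f w t \<partial>lborel) has_field_derivative (\<integral>t. ?f' s t \<partial>lborel)) (at s)"
  proof (rule has_field_derivative_lebesgue_integral[OF S, where b = ?b])
    fix w assume w: "w \<in> S"
    then show "integrable lborel (?f w)"
      using gamma_laplace_integrable[of \<alpha> w] assms unfolding set_integrable_def S_def by auto
    fix t :: real
    show "((\<lambda>w. ?f w t) has_field_derivative ?f' w t) (at w)"
      by (cases "t > 0") (auto intro!: derivative_eq_intros simp: powr[symmetric])
    show "norm (?f' w t) \<le> ?b t"
    proof (cases "t > 0")
      case True
      then have "exp (- (Re w * t)) \<le> exp (- (Re s * t / 2))"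
        using w by (simp add: S_def)
      then show ?thesis
        using True by (auto simp: norm_mult)
    qed auto
  next
    have "set_integrable lborel {0<..} (\<lambda>t. complex_of_real (t powr (\<alpha> + 1 - 1)) * exp (- (of_real (Re s / 2) * of_real t)))"
      using assms by (intro gamma_laplace_integrable) auto
    then show "integrable lborel ?b"
      unfolding set_integrable_def by (rule integrable_norm)
  qed auto
  moreover have "(\<integral>t. ?f' s t \<partial>lborel) = - gamma_laplace (\<alpha> + 1) s"
    unfolding gamma_laplace_def set_lebesgue_integral_def by simp
  ultimately show ?thesis
    unfolding gamma_laplace_def[abs_def] set_lebesgue_integral_def by simp
qed

text \<open>
  The total derivative of \<open>t powr \<alpha> * exp (- s t)\<close> integrates to zero. Combined with
  \<open>gamma_laplace_deriv\<close> this is the differential equation \<open>L' = - (\<alpha> / s) L\<close> for the Laplace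
  transform on the whole right half-plane.
\<close>

lemma gamma_laplace_recurrence:
  assumes "\<alpha> > 0" "Re s > 0"
  shows "s * gamma_laplace (\<alpha> + 1) s = of_real \<alpha> * gamma_laplace \<alpha> s"
proof -
  let ?k = "\<lambda>\<beta> t. complex_of_real (t powr (\<beta> - 1)) * exp (- (s * of_real t))"
  let ?F = "\<lambda>t. complex_of_real (t powr \<alpha>) * exp (- (s * of_real t))"
  have int: "set_integrable lborel {0<..} (?k \<alpha>)" "set_integrable lborel {0<..} (?k (\<alpha> + 1))"
    using assms by (intro gamma_laplace_integrable; simp)+
  have "(LBINT t:{0<..}. of_real \<alpha> * ?k \<alpha> t - s * ?k (\<alpha> + 1) t) = 0 - 0"
  proof (rule set_integral_FTC_Ioi[where F = ?F])
    show "(?F has_vector_derivative of_real \<alpha> * ?k \<alpha> x - s * ?k (\<alpha> + 1) x) (at x)" if "x > 0" for x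
    proof -
      have 1: "((\<lambda>t. complex_of_real (t powr \<alpha>)) has_vector_derivative of_real (\<alpha> * x powr (\<alpha> - 1))) (at x)"
        using that by (intro has_vector_derivative_of_real)
          (auto intro!: derivative_eq_intros simp: has_real_derivative_iff_has_vector_derivative[symmetric])
      have "((\<lambda>z. exp (- (s * z))) has_field_derivative - s * exp (- (s * of_real x))) (at (of_real x))"
        by (auto intro!: derivative_eq_intros)
      then have 2: "((\<lambda>t. exp (- (s * of_real t))) has_vector_derivative - s * exp (- (s * of_real x))) (at x)"
        by (rule has_vector_derivative_real_field)
      show ?thesis
        using has_vector_derivative_mult[OF 1 2] by (simp add: algebra_simps)
    qed
    show "isCont (\<lambda>x. of_real \<alpha> * ?k \<alpha> x - s * ?k (\<alpha> + 1) x) x" if "x > 0" for x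
      using that by (intro continuous_intros) auto
    show "set_integrable lborel {0<..} (\<lambda>t. of_real \<alpha> * ?k \<alpha> t - s * ?k (\<alpha> + 1) t)"
      using int by (intro set_integral_diff set_integrable_mult_right)
    have n: "norm (?F t) = t powr \<alpha> * exp (- (Re s * t))" for t
      by (simp add: norm_mult)
    show "(?F \<longlongrightarrow> 0) (at_right 0)"
    proof (rule tendsto_norm_zero_cancel)
      show "((\<lambda>t. norm (?F t)) \<longlongrightarrow> 0) (at_right 0)"
        unfolding n using assms by real_asymp
    qed
    show "(?F \<longlongrightarrow> 0) at_top"
    proof (rule tendsto_norm_zero_cancel)
      show "((\<lambda>t. norm (?F t)) \<longlongrightarrow> 0) at_top"
        unfolding n using assms by real_asymp
    qed
  qed
  then show ?thesis
    using int unfolding gamma_laplace_def by (simp add: set_integral_diff)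
qed


lemma gamma_laplace_at_1:
  assumes "\<alpha> > 0"
  shows "gamma_laplace \<alpha> 1 = of_real (Gamma \<alpha>)"
proof -
  let ?k = "\<lambda>t. t powr (\<alpha> - 1) * exp (- t)"
  have int: "integrable lborel (\<lambda>t. indicator {0<..} t *\<^sub>R ?k t)"
  proof (rule Bochner_Integration.integrable_bound)
    show "integrable lborel (\<lambda>t. indicator {0<..} t *\<^sub>R (of_real (t powr (\<alpha> - 1)) * exp (- (1 * of_real t)) :: complex))"
      using gamma_laplace_integrable[of \<alpha> 1] assms unfolding set_integrable_def by simp
  qed (auto simp: norm_mult split: split_indicator)
  have "((\<lambda>t. t powr (\<alpha> - 1) / exp t) has_integral Gamma \<alpha>) {0..}"
    by (rule Gamma_integral_real) fact
  then have "(?k has_integral Gamma \<alpha>) {0..}"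
    by (simp add: exp_minus field_simps)
  moreover have "(?k has_integral (LBINT t:{0<..}. ?k t)) {0<..}"
    using int set_borel_integral_eq_integral(1)[of "{0<..}" ?k] set_borel_integral_eq_integral(2)[of "{0<..}" ?k]
    unfolding set_integrable_def by (simp add: has_integral_integrable_integral)
  then have "(?k has_integral (LBINT t:{0<..}. ?k t)) {0..}"
    by (subst has_integral_spike_set_eq[where T = "{0<..}"]) (auto intro: negligible_subset[of "{0::real}"])
  ultimately have "(LBINT t:{0<..}. ?k t) = Gamma \<alpha>"
    by (rule has_integral_unique[rotated])
  moreover have "gamma_laplace \<alpha> 1 = (LBINT t:{0<..}. of_real (?k t))"
    unfolding gamma_laplace_def by (simp add: exp_of_real[symmetric] flip: of_real_minus)
  ultimately show ?thesis
    unfolding set_integral_complex_of_real by simp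
qed

text \<open>
  By the differential equation, \<open>L s * exp (\<alpha> Ln s)\<close> is constant on the right half-plane; its value
  is read off at \<open>s = 1\<close>, where the integral is the Gamma function.
\<close>

lemma gamma_laplace_eq:
  assumes "\<alpha> > 0" "Re s > 0"
  shows "gamma_laplace \<alpha> s = of_real (Gamma \<alpha>) * exp (- of_real \<alpha> * Ln s)"
proof -
  let ?S = "{s. Re s > 0}"
  let ?g = "\<lambda>s. gamma_laplace \<alpha> s * exp (of_real \<alpha> * Ln s)"
  have "\<exists>c. \<forall>s\<in>?S. ?g s = c"
  proof (rule has_field_derivative_zero_constant)
    show "convex ?S"
      by (rule convex_halfspace_Re_gt)
    fix s assume "s \<in> ?S"
    then have s: "Re s > 0" "s \<noteq> 0" "s \<notin> \<real>\<^sub>\<le>\<^sub>0"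
      by (auto simp: complex_nonpos_Reals_iff)
    have rec: "gamma_laplace (\<alpha> + 1) s = of_real \<alpha> * gamma_laplace \<alpha> s / s"
      using gamma_laplace_recurrence[OF assms(1) s(1)] s(2) by (simp add: field_simps)
    have "(?g has_field_derivative - gamma_laplace (\<alpha> + 1) s * exp (of_real \<alpha> * Ln s)
        + exp (of_real \<alpha> * Ln s) * (of_real \<alpha> * inverse s) * gamma_laplace \<alpha> s) (at s)"
      using s by (auto intro!: derivative_eq_intros gamma_laplace_deriv assms)
    then show "(?g has_field_derivative 0) (at s within ?S)"
      unfolding rec by (rule has_field_derivative_at_within[OF DERIV_cong]) (use s in \<open>simp add: field_simps\<close>)
  qed
  then obtain c where c: "\<And>s. Re s > 0 \<Longrightarrow> ?g s = c"
    by blast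
  from c[of 1] have "c = of_real (Gamma \<alpha>)"
    by (simp add: gamma_laplace_at_1 assms)
  with c[OF assms(2)] show ?thesis
    by (simp add: exp_minus field_simps)
qed

lemma gamma_laplace_nat:
  assumes "Re s > 0"
  shows "(LBINT t:{0<..}. exp (- (s * of_real t))) = 1 / s"
    and "(LBINT t:{0<..}. of_real t * exp (- (s * of_real t))) = 1 / s\<^sup>2"
    and "(LBINT t:{0<..}. of_real t ^ 2 * exp (- (s * of_real t))) = 2 / s ^ 3"
proof -
  have [simp]: "s \<noteq> 0"
    using assms by auto
  have G: "Gamma (real (Suc n)) = fact n" for n
    using Gamma_fact[of n, where 'a = real] by (simp add: add.commute)
  have L: "(LBINT t:{0<..}. of_real t ^ n * exp (- (s * of_real t))) = fact n / s ^ Suc n" for n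
  proof -
    have "gamma_laplace (real (Suc n)) s = fact n / s ^ Suc n"
      using assms
      by (subst gamma_laplace_eq) (auto simp: exp_minus exp_of_nat_mult G divide_inverse simp del: of_nat_Suc power_Suc)
    also have "gamma_laplace (real (Suc n)) s = (LBINT t:{0<..}. of_real t ^ n * exp (- (s * of_real t)))"
      unfolding gamma_laplace_def
      by (rule set_lebesgue_integral_cong) (auto simp: powr_realpow)
    finally show ?thesis .
  qed
  from L[of 0] L[of 1] L[of 2] show
    "(LBINT t:{0<..}. exp (- (s * of_real t))) = 1 / s"
    "(LBINT t:{0<..}. of_real t * exp (- (s * of_real t))) = 1 / s\<^sup>2"
    "(LBINT t:{0<..}. of_real t ^ 2 * exp (- (s * of_real t))) = 2 / s ^ 3"
    by (simp_all add: power2_eq_square power3_eq_cube)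
qed

lemma gamma_laplace_nat_integrable:
  assumes "Re s > 0"
  shows "set_integrable lborel {0<..} (\<lambda>t. of_real t ^ n * exp (- (s * of_real t)) :: complex)"
proof -
  have "set_integrable lborel {0<..} (\<lambda>t. of_real (t powr (real (Suc n) - 1)) * exp (- (s * of_real t)) :: complex)"
    using assms by (intro gamma_laplace_integrable) auto
  also have "?this \<longleftrightarrow> ?thesis"
    by (rule set_integrable_cong) (auto simp: powr_realpow)
  finally show ?thesis .
qed

lemma gamma_distribution_Ioi:
  "gamma_distribution \<alpha> =
     density lborel (\<lambda>t. ennreal (indicator {0<..} t * (t powr (\<alpha> - 1) * exp (- t)) / Gamma \<alpha>))"
  unfolding gamma_distribution_def
proof (rule density_cong)
  show "AE t in lborel. ennreal (indicator {0..} t * (t powr (\<alpha> - 1) * exp (- t)) / Gamma \<alpha>)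
      = ennreal (indicator {0<..} t * (t powr (\<alpha> - 1) * exp (- t)) / Gamma \<alpha>)"
    using AE_lborel_singleton[of 0] by eventually_elim (auto split: split_indicator)
qed auto

lemma gamma_distribution_integral:
  fixes f :: "real \<Rightarrow> 'a::{banach, second_countable_topology}"
  assumes \<alpha>: "\<alpha> > 0" and [measurable]: "f \<in> borel_measurable borel"
  shows "(\<integral>t. f t \<partial>gamma_distribution \<alpha>) =
      (LBINT t:{0<..}. (t powr (\<alpha> - 1) * exp (- t) / Gamma \<alpha>) *\<^sub>R f t)" (is ?I)
    and "integrable (gamma_distribution \<alpha>) f \<longleftrightarrow>
      set_integrable lborel {0<..} (\<lambda>t. (t powr (\<alpha> - 1) * exp (- t) / Gamma \<alpha>) *\<^sub>R f t)" (is ?J)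
proof -
  have pos: "AE t in lborel. 0 \<le> indicator {0<..} t * (t powr (\<alpha> - 1) * exp (- t)) / Gamma \<alpha>"
    using Gamma_real_pos[OF \<alpha>] by (auto split: split_indicator)
  show ?I unfolding gamma_distribution_Ioi set_lebesgue_integral_def
    by (subst integral_density[OF _ _ pos]) (auto simp: mult_ac)
  show ?J unfolding gamma_distribution_Ioi set_integrable_def
    by (subst integrable_density[OF _ _ pos]) (auto simp: mult_ac)
qed

lemma real_distribution_gamma:
  assumes "\<alpha> > 0"
  shows "real_distribution (gamma_distribution \<alpha>)"
proof -
  let ?k = "\<lambda>t. indicator {0..} t * t powr (\<alpha> - 1) / exp t"
  have G: "Gamma \<alpha> > 0"
    using assms by (rule Gamma_real_pos)
  have inv: "ennreal (1 / g) * ennreal g = 1" if "g > 0" for g :: real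
    using that by (subst ennreal_mult[symmetric]) auto
  have "emeasure (gamma_distribution \<alpha>) UNIV
      = (\<integral>\<^sup>+t. ennreal (1 / Gamma \<alpha>) * ennreal (?k t) \<partial>lborel)"
    unfolding gamma_distribution_def using G
    by (subst emeasure_density)
      (auto intro!: nn_integral_cong simp: ennreal_mult[symmetric] exp_minus divide_inverse mult_ac)
  also have "\<dots> = ennreal (1 / Gamma \<alpha>) * ennreal (Gamma \<alpha>)"
    by (subst nn_integral_cmult) (auto simp: Gamma_conv_nn_integral_real[OF assms])
  also have "\<dots> = 1"
    using inv[OF G] .
  finally have "prob_space (gamma_distribution \<alpha>)"
    by (intro prob_spaceI) (simp add: gamma_distribution_def)
  then show ?thesis
    by (simp add: real_distribution_def real_distribution_axioms_def gamma_distribution_def)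
qed

lemma char_gamma_distribution:
  assumes "\<alpha> > 0"
  shows "char (gamma_distribution \<alpha>) u = exp (- of_real \<alpha> * Ln (1 - \<i> * of_real u))"
proof -
  have G: "Gamma \<alpha> > 0"
    using assms by (rule Gamma_real_pos)
  have "char (gamma_distribution \<alpha>) u
      = (LBINT t:{0<..}. (t powr (\<alpha> - 1) * exp (- t) / Gamma \<alpha>) *\<^sub>R iexp (u * t))"
    unfolding char_def by (rule gamma_distribution_integral) (use assms in auto)
  also have "\<dots> = (LBINT t:{0<..}. of_real (1 / Gamma \<alpha>) *
      (of_real (t powr (\<alpha> - 1)) * exp (- ((1 - \<i> * of_real u) * of_real t))))"
    by (rule set_lebesgue_integral_cong)
      (auto simp: scaleR_conv_of_real exp_of_real[symmetric] exp_add[symmetric] field_simps simp flip: exp_of_real)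
  also have "\<dots> = of_real (1 / Gamma \<alpha>) * gamma_laplace \<alpha> (1 - \<i> * of_real u)"
    unfolding gamma_laplace_def by (rule set_integral_mult_right)
  also have "\<dots> = exp (- of_real \<alpha> * Ln (1 - \<i> * of_real u))"
    using G[THEN less_imp_neq] assms by (subst gamma_laplace_eq) auto
  finally show ?thesis .
qed

section \<open>Laplace representations of the Cauchy transform and of the free exponent\<close>

lemma (in pair_sigma_finite) integrable_mult_pair:
  fixes g h :: "_ \<Rightarrow> real"
  assumes g: "integrable M1 g" and h: "integrable M2 h"
  shows "integrable (M1 \<Otimes>\<^sub>M M2) (\<lambda>(x, y). g x * h y)"
proof (rule Fubini_integrable)
  have [measurable]: "g \<in> borel_measurable M1" "h \<in> borel_measurable M2"
    using g h by auto
  show "(\<lambda>(x, y). g x * h y) \<in> borel_measurable (M1 \<Otimes>\<^sub>M M2)"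
    by measurable
  show "integrable M1 (\<lambda>x. \<integral>y. norm (case (x, y) of (x, y) \<Rightarrow> g x * h y) \<partial>M2)"
    using g by (simp add: abs_mult)
  show "AE x in M1. integrable M2 (\<lambda>y. case (x, y) of (x, y) \<Rightarrow> g x * h y)"
    using h by simp
qed

text \<open>
  The growth bound in \<open>s\<close> accommodates both kernels needed below: characters, which are bounded,
  and the compensated kernel of the Levy--Khintchine formula, which grows quadratically.
\<close>

lemma laplace_Fubini:
  fixes k :: "real \<Rightarrow> real \<Rightarrow> complex"
  assumes sf: "sigma_finite_measure M" and sets: "sets M = sets borel"
    and p: "Re p > 0"
    and k: "(\<lambda>(s, t). k s t) \<in> borel_measurable (borel \<Otimes>\<^sub>M borel)"
    and bound: "\<And>s t. s > 0 \<Longrightarrow> norm (k s t) \<le> (c + s ^ 2) * h t"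
    and h: "integrable M h"
  shows "(LBINT s:{0<..}. exp (- (p * of_real s)) * (\<integral>t. k s t \<partial>M))
       = (\<integral>t. (LBINT s:{0<..}. exp (- (p * of_real s)) * k s t) \<partial>M)" (is ?eq)
    and "set_integrable lborel {0<..} (\<lambda>s. exp (- (p * of_real s)) * (\<integral>t. k s t \<partial>M))" (is ?int)
proof -
  interpret sigma_finite_measure M by fact
  interpret pair_sigma_finite lborel M ..
  note [measurable_cong] = sets
  note [measurable] = k
  let ?e = "\<lambda>n s. norm (indicator {0<..} s *\<^sub>R (of_real s ^ n * exp (- (p * of_real s)) :: complex))"
  have e: "integrable lborel (?e n)" for n
    using gamma_laplace_nat_integrable[OF p, of n] unfolding set_integrable_def by (rule integrable_norm)
  let ?b = "\<lambda>(s, t). (c * ?e 0 s + ?e 2 s) * h t"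
  let ?f = "\<lambda>s t. indicator {0<..} s *\<^sub>R (exp (- (p * of_real s)) * k s t)"
  have "integrable (lborel \<Otimes>\<^sub>M M) ?b"
    by (intro integrable_mult_pair Bochner_Integration.integrable_add integrable_mult_right e h)
  then have int: "integrable (lborel \<Otimes>\<^sub>M M) (\<lambda>(s, t). ?f s t)"
  proof (rule Bochner_Integration.integrable_bound)
    show "(\<lambda>(s, t). ?f s t) \<in> borel_measurable (lborel \<Otimes>\<^sub>M M)"
      by measurable
    have "norm (?f s t) \<le> norm ((c * ?e 0 s + ?e 2 s) * h t)" for s t
    proof (cases "s > 0")
      case True
      let ?E = "norm (exp (- (p * of_real s)))"
      have "norm (?f s t) = ?E * norm (k s t)"
        using True by (simp add: norm_mult)
      also have "\<dots> \<le> ?E * ((c + s ^ 2) * h t)"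
        by (intro mult_left_mono bound True) auto
      also have "\<dots> = (c * ?e 0 s + ?e 2 s) * h t"
        using True by (simp add: norm_mult norm_power algebra_simps)
      finally show ?thesis
        by simp
    qed simp
    then show "AE x in lborel \<Otimes>\<^sub>M M. norm (case x of (s, t) \<Rightarrow> ?f s t) \<le> norm (?b x)"
      by (intro AE_I2) (simp add: split_beta)
  qed
  have fst: "(\<integral>t. ?f s t \<partial>M) = indicator {0<..} s *\<^sub>R (exp (- (p * of_real s)) * (\<integral>t. k s t \<partial>M))" for s
    by simp
  show ?eq
    using Fubini_integral[OF int] unfolding fst set_lebesgue_integral_def by simp
  show ?int
    using integrable_fst[OF int] unfolding fst set_integrable_def .
qed

text \<open>
  The resolvent kernel is the Laplace transform of a character:
  \<open>1 / (p + i t) = \<integral> exp (- p s) exp (- i s t) ds\<close>, integrated over the law of \<open>t\<close>.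
\<close>

lemma (in real_distribution) cauchy_transform_laplace_char:
  assumes p: "Re p > 0"
  shows "cauchy_transform M (\<i> * p) = - \<i> * (LBINT s:{0<..}. exp (- (p * of_real s)) * char M (- s))"
proof -
  have "(LBINT s:{0<..}. exp (- (p * of_real s)) * char M (- s))
      = (\<integral>t. (LBINT s:{0<..}. exp (- (p * of_real s)) * iexp (- s * t)) \<partial>M)"
    unfolding char_def
    by (rule laplace_Fubini[where c = 1 and h = "\<lambda>_. 1"]) (use p sigma_finite_measure_axioms in auto)
  also have "\<dots> = (\<integral>t. \<i> * (1 / (\<i> * p - of_real t)) \<partial>M)"
  proof (rule Bochner_Integration.integral_cong)
    fix t
    have "(LBINT s:{0<..}. exp (- (p * of_real s)) * iexp (- s * t))
        = (LBINT s:{0<..}. exp (- ((p + \<i> * of_real t) * of_real s)))"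
      by (simp add: exp_add[symmetric] algebra_simps)
    also have "\<dots> = 1 / (p + \<i> * of_real t)"
      using p by (intro gamma_laplace_nat) simp
    also have "\<dots> = \<i> * (1 / (\<i> * p - of_real t))"
    proof -
      have "p + \<i> * of_real t = - \<i> * (\<i> * p - of_real t)"
        by (simp add: algebra_simps)
      then show ?thesis
        by (simp add: divide_inverse inverse_mult_distrib)
    qed
    finally show "(LBINT s:{0<..}. exp (- (p * of_real s)) * iexp (- s * t)) = \<i> * (1 / (\<i> * p - of_real t))" .
  qed simp
  also have "\<dots> = \<i> * cauchy_transform M (\<i> * p)"
    unfolding cauchy_transform_def by (rule integral_mult_right_zero)
  finally show ?thesis
    by simp
qed

definition levy_kernel :: "real \<Rightarrow> real \<Rightarrow> complex" where
  "levy_kernel u t = exp (\<i> * of_real (u * t)) - 1 - \<i> * of_real (u * t * indicator {-1..1} t)"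

definition levy_exponent :: "real \<Rightarrow> real measure \<Rightarrow> real \<Rightarrow> real \<Rightarrow> complex" where
  "levy_exponent a \<rho> \<eta> u =
     \<i> * of_real (\<eta> * u) - of_real (a * u\<^sup>2 / 2) + (\<integral>t. levy_kernel u t \<partial>\<rho>)"

text \<open>
  Near the origin the compensator leaves the second-order Taylor remainder; away from it the kernel
  is a difference of two numbers of modulus one.
\<close>

lemma levy_kernel_bound: "norm (levy_kernel u t) \<le> (2 + u\<^sup>2) * min 1 (t\<^sup>2)"
proof (cases "\<bar>t\<bar> \<le> 1")
  case True
  then have t: "t\<^sup>2 \<le> 1" "t \<in> {-1..1}"
    by (auto simp: abs_square_le_1)
  have "norm (levy_kernel u t) \<le> \<bar>u * t\<bar>\<^sup>2 / 2"
    using iexp_approx1[of "u * t" 1] t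
    by (simp add: levy_kernel_def numeral_2_eq_2 algebra_simps)
  also have "\<dots> \<le> (2 + u\<^sup>2) * t\<^sup>2"
    by (simp add: power_mult_distrib algebra_simps)
  finally show ?thesis
    using t by simp
next
  case False
  then have t: "1 \<le> t\<^sup>2" "t \<notin> {-1..1}"
    using abs_square_le_1[of t] by (auto simp: abs_le_iff)
  have "norm (levy_kernel u t) \<le> norm (iexp (u * t)) + 1"
    using t norm_triangle_ineq4[of "iexp (u * t)" 1] by (simp add: levy_kernel_def)
  also have "\<dots> \<le> 2 + u\<^sup>2"
    by (simp del: of_real_mult)
  finally show ?thesis
    using t by simp
qed

lemma levy_measure_sets: "levy_measure \<rho> \<Longrightarrow> sets \<rho> = sets borel"
  by (simp add: levy_measure_def)

lemma levy_measure_integrable_min: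
  assumes "levy_measure \<rho>"
  shows "integrable \<rho> (\<lambda>t. min 1 (t\<^sup>2))"
proof (rule integrableI_nonneg)
  show "(\<lambda>t. min 1 (t\<^sup>2)) \<in> borel_measurable \<rho>"
    using levy_measure_sets[OF assms] by (simp cong: measurable_cong_sets)
qed (use assms in \<open>auto simp: levy_measure_def\<close>)

text \<open>
  The sets where \<open>min 1 (t\<^sup>2)\<close> exceeds a positive level have finite mass by Markov's inequality, and
  they exhaust everything except the origin, which has no mass.
\<close>

lemma levy_measure_sigma_finite:
  assumes "levy_measure \<rho>"
  shows "sigma_finite_measure \<rho>"
proof
  note [measurable_cong] = levy_measure_sets[OF assms]
  have space: "space \<rho> = UNIV"
    using sets_eq_imp_space_eq[OF levy_measure_sets[OF assms]] by simp
  let ?A = "\<lambda>n. {t \<in> UNIV. 1 \<le> ennreal (real (Suc n)) * ennreal (min 1 (t\<^sup>2))}"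
  have "emeasure \<rho> (?A n) < \<infinity>" for n
  proof -
    have "emeasure \<rho> (?A n) \<le> ennreal (real (Suc n)) * (\<integral>\<^sup>+t. ennreal (min 1 (t\<^sup>2)) * indicator UNIV t \<partial>\<rho>)"
      by (rule nn_integral_Markov_inequality) (use space[symmetric] in auto)
    also have "\<dots> < \<infinity>"
      using assms by (simp add: levy_measure_def ennreal_mult_less_top del: of_nat_Suc)
    finally show ?thesis .
  qed
  moreover have "t \<in> (\<Union>n. ?A n)" if "t \<noteq> 0" for t
  proof -
    obtain n where "1 / min 1 (t\<^sup>2) < real n"
      using reals_Archimedean2 by blast
    then have "1 \<le> real (Suc n) * min 1 (t\<^sup>2)"
      using that by (auto simp: divide_less_eq min_def distrib_right split: if_splits intro: order_trans[OF less_imp_le])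
    then have "t \<in> ?A n"
      by (simp add: ennreal_mult[symmetric] del: of_nat_Suc)
    then show ?thesis by blast
  qed
  then have "(\<Union>n. ?A n) \<union> {0} = UNIV"
    by blast
  ultimately show "\<exists>A. countable A \<and> A \<subseteq> sets \<rho> \<and> \<Union> A = space \<rho> \<and> (\<forall>a\<in>A. emeasure \<rho> a \<noteq> \<infinity>)"
    using assms space
    by (intro exI[of _ "insert {0} (range ?A)"])
      (auto simp: levy_measure_def less_top[symmetric] Un_commute simp del: of_nat_Suc UN_simps)
qed

lemma levy_kernel_integrable:
  assumes "levy_measure \<rho>"
  shows "integrable \<rho> (levy_kernel u)"
proof (rule Bochner_Integration.integrable_bound)
  show "integrable \<rho> (\<lambda>t. (2 + u\<^sup>2) * min 1 (t\<^sup>2))"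
    using levy_measure_integrable_min[OF assms] by simp
  show "levy_kernel u \<in> borel_measurable \<rho>"
    using levy_measure_sets[OF assms] unfolding levy_kernel_def[abs_def]
    by (simp cong: measurable_cong_sets)
qed (use levy_kernel_bound in auto)

lemma levy_exponent_continuous:
  assumes "levy_measure \<rho>"
  shows "continuous_on UNIV (levy_exponent a \<rho> \<eta>)"
proof -
  have "isCont (levy_exponent a \<rho> \<eta>) x" for x
  proof -
    define R where "R = \<bar>x\<bar> + 1"
    have "continuous_on {-R<..<R} (\<lambda>u. \<integral>t. levy_kernel u t \<partial>\<rho>)"
    proof (rule continuous_on_lebesgue_integral[where b = "\<lambda>t. (2 + R\<^sup>2) * min 1 (t\<^sup>2)"])
      fix u assume u: "u \<in> {-R<..<R}"
      show "levy_kernel u \<in> borel_measurable \<rho>"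
        using levy_kernel_integrable[OF assms] by auto
      have "u\<^sup>2 \<le> R\<^sup>2"
        using u by (auto simp: abs_le_square_iff[symmetric])
      then have "(2 + u\<^sup>2) * min 1 (t\<^sup>2) \<le> (2 + R\<^sup>2) * min 1 (t\<^sup>2)" for t
        by (intro mult_right_mono) auto
      then show "AE t in \<rho>. norm (levy_kernel u t) \<le> (2 + R\<^sup>2) * min 1 (t\<^sup>2)"
        using levy_kernel_bound order_trans by blast
    next
      show "AE t in \<rho>. continuous_on {-R<..<R} (\<lambda>u. levy_kernel u t)"
        unfolding levy_kernel_def by (intro AE_I2 continuous_intros)
      show "integrable \<rho> (\<lambda>t. (2 + R\<^sup>2) * min 1 (t\<^sup>2))"
        using levy_measure_integrable_min[OF assms] by simp
    qed
    then have "continuous_on {-R<..<R} (levy_exponent a \<rho> \<eta>)"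
      unfolding levy_exponent_def[abs_def] by (intro continuous_intros) auto
    moreover have "x \<in> {-R<..<R}"
      by (auto simp: R_def)
    ultimately show ?thesis
      by (simp add: continuous_on_eq_continuous_at)
  qed
  then show ?thesis
    by (simp add: continuous_on_eq_continuous_at)
qed

text \<open>
  The exponent and \<open>- \<alpha> Ln (1 - i u)\<close> are continuous logarithms of the same characteristic function.
  Their difference takes values in \<open>2 \<pi> i \<int>\<close>, so it is constant, and it vanishes at \<open>0\<close>.
\<close>

lemma levy_exponent_gamma:
  assumes "\<alpha> > 0" and trip: "characteristic_triplet (gamma_distribution \<alpha>) a \<rho> \<eta>"
  shows "levy_exponent a \<rho> \<eta> u = - of_real \<alpha> * Ln (1 - \<i> * of_real u)"
proof -
  have levy: "levy_measure \<rho>"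
    using trip by (simp add: characteristic_triplet_def)
  define f where "f u = levy_exponent a \<rho> \<eta> u + of_real \<alpha> * Ln (1 - \<i> * of_real u)" for u
  have nonpos: "1 - \<i> * of_real u \<notin> \<real>\<^sub>\<le>\<^sub>0" for u
    by (auto simp: complex_nonpos_Reals_iff)
  have "exp (levy_exponent a \<rho> \<eta> u) = char (gamma_distribution \<alpha>) u" for u
    using trip unfolding characteristic_triplet_def levy_exponent_def levy_kernel_def by simp
  then have exp_f: "exp (f u) = 1" for u
    using char_gamma_distribution[OF assms(1), of u]
    by (simp add: f_def exp_add exp_minus)
  have "f constant_on UNIV"
  proof (rule continuous_discrete_range_constant)
    show "continuous_on UNIV f"
      unfolding f_def[abs_def] using nonpos
      by (intro continuous_intros levy_exponent_continuous[OF levy]) auto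
    show "\<exists>e>0. \<forall>y. y \<in> UNIV \<and> f y \<noteq> f x \<longrightarrow> e \<le> norm (f y - f x)" for x
    proof (intro exI[of _ "2 * pi"] conjI allI impI)
      fix y assume y: "y \<in> UNIV \<and> f y \<noteq> f x"
      have "exp (f y) = exp (f x)"
        by (simp add: exp_f)
      then obtain n :: int where n: "f y = f x + of_int (2 * n) * pi * \<i>"
        unfolding exp_eq by blast
      with y have "n \<noteq> 0" by auto
      then have "1 \<le> \<bar>real_of_int n\<bar>"
        by linarith
      then show "2 * pi \<le> norm (f y - f x)"
        by (simp add: n norm_mult)
    qed simp
  qed simp
  then have "f u = f 0"
    by (auto simp: constant_on_def)
  also have "f 0 = 0"
    by (simp add: f_def levy_exponent_def levy_kernel_def)
  finally show ?thesis
    by (simp add: f_def eq_neg_iff_add_eq_0)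
qed

definition free_levy_exponent :: "real \<Rightarrow> real measure \<Rightarrow> real \<Rightarrow> complex \<Rightarrow> complex" where
  "free_levy_exponent a \<rho> \<eta> z = of_real \<eta> * z + of_real a * z\<^sup>2 +
     (\<integral>t. 1 / (1 - of_real t * z) - 1 - of_real (t * indicator {-1..1} t) * z \<partial>\<rho>)"

text \<open>
  The Laplace transform turns each term of the classical kernel into the matching term of the free
  kernel at \<open>z = 1 / (i p)\<close>; the factor \<open>p\<close> normalises the constant term.
\<close>

lemma laplace_levy_kernel:
  assumes p: "Re p > 0"
  shows "p * (LBINT s:{0<..}. exp (- (p * of_real s)) * levy_kernel (- s) t)
       = 1 / (1 - of_real t * (1 / (\<i> * p))) - 1 - of_real (t * indicator {-1..1} t) * (1 / (\<i> * p))"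
proof -
  let ?t1 = "complex_of_real (t * indicator {-1..1} t)"
  let ?q = "p + \<i> * of_real t"
  have q: "Re ?q > 0"
    using p by simp
  have [simp]: "p \<noteq> 0"
    using p by auto
  have int: "set_integrable lborel {0<..} (\<lambda>s. exp (- (?q * of_real s)) :: complex)"
    "set_integrable lborel {0<..} (\<lambda>s. exp (- (p * of_real s)) :: complex)"
    "set_integrable lborel {0<..} (\<lambda>s. \<i> * ?t1 * (of_real s * exp (- (p * of_real s))) :: complex)"
    using gamma_laplace_nat_integrable[OF q, of 0] gamma_laplace_nat_integrable[OF p, of 0]
      gamma_laplace_nat_integrable[OF p, of 1] by simp_all
  have "(LBINT s:{0<..}. exp (- (p * of_real s)) * levy_kernel (- s) t)
      = (LBINT s:{0<..}. exp (- (?q * of_real s)) - exp (- (p * of_real s))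
           + \<i> * ?t1 * (of_real s * exp (- (p * of_real s))))"
    by (rule set_lebesgue_integral_cong)
      (auto simp: levy_kernel_def algebra_simps exp_add[symmetric])
  also have "\<dots> = 1 / ?q - 1 / p + \<i> * ?t1 * (1 / p\<^sup>2)"
    using int gamma_laplace_nat(1)[OF q] gamma_laplace_nat(1,2)[OF p]
    by (simp only: set_integral_add set_integral_diff set_integral_mult_right)
  also have "p * \<dots> = p / ?q - 1 + \<i> * ?t1 / p"
    by (simp add: algebra_simps power2_eq_square)
  also have "p / ?q = 1 / (1 - of_real t * (1 / (\<i> * p)))"
  proof -
    have "1 - of_real t * (1 / (\<i> * p)) = ?q / p"
      by (simp add: field_simps)
    then show ?thesis by simp
  qed
  also have "\<i> * ?t1 / p = - (?t1 * (1 / (\<i> * p)))"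
    by (simp add: field_simps)
  finally show ?thesis
    by simp
qed

text \<open>
  The relation between the classical and the free exponent of one triplet: the Gaussian part and the
  drift are moments of the exponential law, and the jump part is \<open>laplace_levy_kernel\<close> integrated
  against the Levy measure by Fubini's theorem.
\<close>

lemma free_levy_exponent_laplace:
  assumes levy: "levy_measure \<rho>" and p: "Re p > 0"
  shows "free_levy_exponent a \<rho> \<eta> (1 / (\<i> * p))
       = p * (LBINT s:{0<..}. exp (- (p * of_real s)) * levy_exponent a \<rho> \<eta> (- s))"
proof -
  let ?e = "\<lambda>s. exp (- (p * complex_of_real s))"
  let ?J = "\<lambda>s. \<integral>t. levy_kernel (- s) t \<partial>\<rho>"
  have [simp]: "p \<noteq> 0"
    using p by auto
  have k: "(\<lambda>(s, t). levy_kernel (- s) t) \<in> borel_measurable (borel \<Otimes>\<^sub>M borel)"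
    unfolding levy_kernel_def by measurable
  have bound: "norm (levy_kernel (- s) t) \<le> (2 + s ^ 2) * min 1 (t\<^sup>2)" for s t
    using levy_kernel_bound[of "- s" t] by simp
  note F = laplace_Fubini[OF levy_measure_sigma_finite[OF levy] levy_measure_sets[OF levy] p k bound
      levy_measure_integrable_min[OF levy]]
  have int: "set_integrable lborel {0<..} (\<lambda>s. - \<i> * of_real \<eta> * (of_real s * ?e s))"
    "set_integrable lborel {0<..} (\<lambda>s. - of_real (a / 2) * (of_real s ^ 2 * ?e s))"
    "set_integrable lborel {0<..} (\<lambda>s. ?e s * ?J s)"
    using gamma_laplace_nat_integrable[OF p, of 1] gamma_laplace_nat_integrable[OF p, of 2] F(2)
    unfolding power_one_right by - (intro set_integrable_mult_right; assumption)+
  have "(LBINT s:{0<..}. ?e s * levy_exponent a \<rho> \<eta> (- s))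
      = (LBINT s:{0<..}. - \<i> * of_real \<eta> * (of_real s * ?e s)
          + - of_real (a / 2) * (of_real s ^ 2 * ?e s) + ?e s * ?J s)"
    by (rule set_lebesgue_integral_cong) (auto simp: levy_exponent_def algebra_simps)
  also have "\<dots> = - \<i> * of_real \<eta> * (1 / p\<^sup>2) + - of_real (a / 2) * (2 / p ^ 3)
      + (LBINT s:{0<..}. ?e s * ?J s)"
    using int gamma_laplace_nat(2,3)[OF p]
    by (simp only: set_integral_add set_integral_mult_right)
  also have "(LBINT s:{0<..}. ?e s * ?J s) = (\<integral>t. (LBINT s:{0<..}. ?e s * levy_kernel (- s) t) \<partial>\<rho>)"
    by (rule F(1))
  also have "p * (- \<i> * of_real \<eta> * (1 / p\<^sup>2) + - of_real (a / 2) * (2 / p ^ 3) + \<dots>)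
      = of_real \<eta> * (1 / (\<i> * p)) + of_real a * (1 / (\<i> * p))\<^sup>2
        + p * (\<integral>t. (LBINT s:{0<..}. ?e s * levy_kernel (- s) t) \<partial>\<rho>)"
    by (simp add: distrib_left) (simp add: field_simps power2_eq_square power3_eq_cube)
  also have "p * (\<integral>t. (LBINT s:{0<..}. ?e s * levy_kernel (- s) t) \<partial>\<rho>)
      = (\<integral>t. p * (LBINT s:{0<..}. ?e s * levy_kernel (- s) t) \<partial>\<rho>)"
    by simp
  finally show ?thesis
    unfolding laplace_levy_kernel[OF p] free_levy_exponent_def by simp
qed

lemma norm_Ln_one_plus_i_le:
  assumes "s \<ge> 0"
  shows "norm (Ln (1 + \<i> * of_real s)) \<le> s + pi"
proof -
  let ?z = "1 + \<i> * complex_of_real s"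
  have nz: "?z \<noteq> 0"
    by (auto simp: complex_eq_iff)
  have "1 \<le> norm ?z"
    using complex_Re_le_cmod[of ?z] by simp
  moreover have "norm ?z \<le> 1 + s"
    using norm_triangle_ineq[of 1 "\<i> * complex_of_real s"] assms by (simp add: norm_mult)
  ultimately have "0 \<le> ln (norm ?z)" "ln (norm ?z) \<le> ln (1 + s)"
    by (auto intro!: ln_mono simp del: ln_le_cancel_iff)
  moreover have "ln (1 + s) \<le> s"
    using assms by (rule ln_add_one_self_le_self)
  ultimately have "\<bar>Re (Ln ?z)\<bar> \<le> s"
    using nz by simp
  moreover have "\<bar>Im (Ln ?z)\<bar> \<le> pi"
    using mpi_less_Im_Ln[OF nz] Im_Ln_le_pi[OF nz] by linarith
  ultimately show ?thesis
    using cmod_le[of "Ln ?z"] by linarith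
qed

text \<open>
  Integration by parts; the boundary terms vanish because \<open>Ln 1 = 0\<close> and because the logarithm grows at
  most linearly.
\<close>

lemma laplace_Ln:
  assumes p: "Re p > 0"
  shows "p * (LBINT s:{0<..}. exp (- (p * of_real s)) * Ln (1 + \<i> * of_real s))
       = \<i> * (LBINT s:{0<..}. exp (- (p * of_real s)) * (1 / (1 + \<i> * of_real s)))"
proof -
  let ?e = "\<lambda>s. exp (- (p * complex_of_real s))"
  let ?L = "\<lambda>s. Ln (1 + \<i> * complex_of_real s)"
  have nz: "1 + \<i> * complex_of_real s \<notin> \<real>\<^sub>\<le>\<^sub>0" "1 + \<i> * complex_of_real s \<noteq> 0" for s
    by (auto simp: complex_nonpos_Reals_iff complex_eq_iff)
  have E: "set_integrable lborel {0<..} ?e" "set_integrable lborel {0<..} (\<lambda>s. of_real s * ?e s)"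
    using gamma_laplace_nat_integrable[OF p, of 0] gamma_laplace_nat_integrable[OF p, of 1] by simp_all
  have "set_integrable lborel {0<..} (\<lambda>s. of_real s * ?e s + of_real pi * ?e s)"
    using E by (intro set_integral_add set_integrable_mult_right)
  then have i1: "set_integrable lborel {0<..} (\<lambda>s. ?e s * ?L s)"
  proof (rule set_integrable_bound)
    show "AE s in lborel. s \<in> {0<..} \<longrightarrow> norm (?e s * ?L s) \<le> norm (of_real s * ?e s + of_real pi * ?e s)"
    proof (intro AE_I2 impI)
      fix s :: real assume s: "s \<in> {0<..}"
      have "norm (?e s * ?L s) \<le> norm (?e s) * (s + pi)"
        unfolding norm_mult using s norm_Ln_one_plus_i_le[of s] by (intro mult_left_mono) auto
      also have "of_real s * ?e s + of_real pi * ?e s = of_real (s + pi) * ?e s"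
        by (simp add: algebra_simps)
      then have "norm (?e s) * (s + pi) = norm (of_real s * ?e s + of_real pi * ?e s)"
        using s by (simp only: norm_mult norm_of_real) simp
      finally show "norm (?e s * ?L s) \<le> norm (of_real s * ?e s + of_real pi * ?e s)" .
    qed
  qed (auto simp: set_borel_measurable_def)
  have i2: "set_integrable lborel {0<..} (\<lambda>s. ?e s * (1 / (1 + \<i> * of_real s)))"
    using E(1)
  proof (rule set_integrable_bound)
    have "1 \<le> norm (1 + \<i> * complex_of_real s)" for s
      using complex_Re_le_cmod[of "1 + \<i> * complex_of_real s"] by simp
    then have "norm (?e s * (1 / (1 + \<i> * of_real s))) \<le> norm (?e s)" for s
      by (simp add: norm_mult norm_divide divide_le_eq mult_le_cancel_left1 del: norm_exp_eq_Re)
    then show "AE s in lborel. s \<in> {0<..} \<longrightarrow> norm (?e s * (1 / (1 + \<i> * of_real s))) \<le> norm (?e s)"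
      by blast
  qed (auto simp: set_borel_measurable_def)
  have "(LBINT s:{0<..}. \<i> * (?e s * (1 / (1 + \<i> * of_real s))) - p * (?e s * ?L s)) = 0 - 0"
  proof (rule set_integral_FTC_Ioi[where F = "\<lambda>s. ?e s * ?L s"])
    fix s :: real assume "s > 0"
    have "((\<lambda>z. exp (- (p * z)) * Ln (1 + \<i> * z)) has_field_derivative
        \<i> * (?e s * (1 / (1 + \<i> * of_real s))) - p * (?e s * ?L s)) (at (of_real s))"
      using nz[of s] by (auto intro!: derivative_eq_intros simp: field_simps)
    then show "((\<lambda>s. ?e s * ?L s) has_vector_derivative
        \<i> * (?e s * (1 / (1 + \<i> * of_real s))) - p * (?e s * ?L s)) (at s)"
      by (rule has_vector_derivative_real_field)
    show "isCont (\<lambda>s. \<i> * (?e s * (1 / (1 + \<i> * of_real s))) - p * (?e s * ?L s)) s"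
      using nz[of s] by (intro continuous_intros) auto
  next
    show "set_integrable lborel {0<..} (\<lambda>s. \<i> * (?e s * (1 / (1 + \<i> * of_real s))) - p * (?e s * ?L s))"
      using i1 i2 by (intro set_integral_diff set_integrable_mult_right)
    have "isCont (\<lambda>s. ?e s * ?L s) 0"
      using nz[of 0] by (intro continuous_intros) auto
    then show "((\<lambda>s. ?e s * ?L s) \<longlongrightarrow> 0) (at_right 0)"
      by (simp add: isCont_def filterlim_at_split)
    have "((\<lambda>s. exp (- (Re p * s)) * (s + pi)) \<longlongrightarrow> 0) at_top"
      using p by real_asymp
    then show "((\<lambda>s. ?e s * ?L s) \<longlongrightarrow> 0) at_top"
    proof (rule Lim_null_comparison[rotated])
      show "\<forall>\<^sub>F s in at_top. norm (?e s * ?L s) \<le> exp (- (Re p * s)) * (s + pi)"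
        using eventually_ge_at_top[of 0]
      proof eventually_elim
        case (elim s)
        have "norm (?e s * ?L s) = exp (- (Re p * s)) * norm (?L s)"
          by (simp add: norm_mult)
        also have "\<dots> \<le> exp (- (Re p * s)) * (s + pi)"
          using elim by (intro mult_left_mono norm_Ln_one_plus_i_le) auto
        finally show ?case .
      qed
    qed
  qed
  moreover have "(LBINT s:{0<..}. \<i> * (?e s * (1 / (1 + \<i> * of_real s))) - p * (?e s * ?L s))
      = \<i> * (LBINT s:{0<..}. ?e s * (1 / (1 + \<i> * of_real s))) - p * (LBINT s:{0<..}. ?e s * ?L s)"
    using i1 i2 by (simp only: set_integral_diff set_integrable_mult_right set_integral_mult_right)
  ultimately show ?thesis
    by simp
qed

proposition free_levy_exponent_gamma:
  assumes \<alpha>: "\<alpha> > 0" and trip: "characteristic_triplet (gamma_distribution \<alpha>) a \<rho> \<eta>"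
    and z: "Im z > 0"
  shows "free_levy_exponent a \<rho> \<eta> (1 / z) = of_real \<alpha> * cauchy_transform (gamma_distribution 1) z"
proof -
  define p where "p = - \<i> * z"
  have p: "Re p > 0" and z_eq: "z = \<i> * p"
    using z by (simp_all add: p_def)
  have levy: "levy_measure \<rho>"
    using trip by (simp add: characteristic_triplet_def)
  interpret G: real_distribution "gamma_distribution 1"
    by (rule real_distribution_gamma) simp
  have char: "char (gamma_distribution 1) (- s) = 1 / (1 + \<i> * of_real s)" for s
  proof -
    have "1 + \<i> * complex_of_real s \<noteq> 0"
      by (auto simp: complex_eq_iff)
    then show ?thesis
      by (simp add: char_gamma_distribution exp_minus divide_inverse)
  qed
  have "free_levy_exponent a \<rho> \<eta> (1 / z)
      = p * (LBINT s:{0<..}. exp (- (p * of_real s)) * levy_exponent a \<rho> \<eta> (- s))"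
    unfolding z_eq using levy p by (rule free_levy_exponent_laplace)
  also have "\<dots> = p * (LBINT s:{0<..}. - of_real \<alpha> * (exp (- (p * of_real s)) * Ln (1 + \<i> * of_real s)))"
    unfolding levy_exponent_gamma[OF \<alpha> trip] by (simp only: of_real_minus mult_minus_right mult_minus_left diff_minus_eq_add mult.left_commute)
  also have "\<dots> = - of_real \<alpha> * (p * (LBINT s:{0<..}. exp (- (p * of_real s)) * Ln (1 + \<i> * of_real s)))"
    by (simp only: set_integral_mult_right mult.left_commute)
  also have "\<dots> = of_real \<alpha> * (- \<i> * (LBINT s:{0<..}. exp (- (p * of_real s)) * char (gamma_distribution 1) (- s)))"
    unfolding laplace_Ln[OF p] char by simp
  also have "\<dots> = of_real \<alpha> * cauchy_transform (gamma_distribution 1) z"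
    unfolding z_eq G.cauchy_transform_laplace_char[OF p] ..
  finally show ?thesis .
qed

section \<open>Uniqueness of the free cumulant transform\<close>

lemma Im_one_over_pos_iff: "Im (1 / z) > 0 \<longleftrightarrow> Im z < 0"
proof -
  have "Im (1 / z) = - Im z / (norm z)\<^sup>2"
    by (simp add: Im_divide cmod_power2)
  then show ?thesis
    by (cases "z = 0") (auto simp: divide_less_0_iff zero_less_divide_iff)
qed

lemma analytic_continuation_imaginary_axis:
  assumes hol: "f holomorphic_on S" and S: "open S" "connected S" and w: "w \<in> S"
    and ev: "\<forall>\<^sub>F x in at_top. \<i> * of_real x \<in> S \<and> f (\<i> * of_real x) = 0"
  shows "f w = 0"
proof -
  obtain X where X: "\<And>x. x \<ge> X \<Longrightarrow> \<i> * of_real x \<in> S \<and> f (\<i> * of_real x) = 0"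
    using ev by (auto simp: eventually_at_top_linorder)
  define U where "U = (\<lambda>x. \<i> * complex_of_real x) ` {X..}"
  show ?thesis
  proof (rule analytic_continuation[OF hol S])
    show "U \<subseteq> S" "\<i> * of_real X \<in> S" "\<And>z. z \<in> U \<Longrightarrow> f z = 0"
      using X by (auto simp: U_def)
    show "\<i> * of_real X islimpt U"
      unfolding islimpt_sequential
    proof (intro exI[of _ "\<lambda>n. \<i> * complex_of_real (X + 1 / real (Suc n))"] conjI allI)
      fix n
      show "\<i> * complex_of_real (X + 1 / real (Suc n)) \<in> U - {\<i> * of_real X}"
        by (auto simp: U_def simp del: of_real_add of_nat_Suc)
      have "(\<lambda>n. X + 1 / real (Suc n)) \<longlonglongrightarrow> X + 0"
        by (intro tendsto_add tendsto_const LIMSEQ_Suc lim_1_over_n)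
      then have "(\<lambda>n. \<i> * complex_of_real (X + 1 / real (Suc n))) \<longlonglongrightarrow> \<i> * complex_of_real (X + 0)"
        by (intro tendsto_mult tendsto_const tendsto_of_real)
      then show "(\<lambda>n. \<i> * complex_of_real (X + 1 / real (Suc n))) \<longlonglongrightarrow> \<i> * of_real X"
        by simp
    qed
  qed fact
qed

lemma imaginary_axis_in_truncated_cone:
  assumes "\<eta> > 0" "x > 0" "x > M"
  shows "\<i> * of_real x \<in> truncated_cone \<eta> M"
  using assms by (simp add: truncated_cone_def)

lemma cauchy_right_inverse_imaginary_axis:
  assumes g: "cauchy_right_inverse \<mu> \<eta> M g" and \<eta>: "\<eta> > 0"
  shows "((\<lambda>x. g (1 / (\<i> * of_real x)) / (\<i> * of_real x)) \<longlongrightarrow> 1) at_top"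
    and "\<forall>\<^sub>F x in at_top. Im (g (1 / (\<i> * of_real x))) > 0 \<and>
        cauchy_transform \<mu> (g (1 / (\<i> * of_real x))) = 1 / (\<i> * of_real x)"
proof -
  let ?\<xi> = "\<lambda>x. 1 / (\<i> * complex_of_real x)"
  let ?D = "{z. 1 / z \<in> truncated_cone \<eta> M}"
  have ev: "\<forall>\<^sub>F x in at_top. ?\<xi> x \<in> ?D \<and> x > 0"
    using eventually_gt_at_top[of M] eventually_gt_at_top[of 0]
    by eventually_elim (use imaginary_axis_in_truncated_cone[OF \<eta>] in auto)
  have "filterlim ?\<xi> (at 0 within ?D) at_top"
    unfolding filterlim_at
  proof
    show "\<forall>\<^sub>F x in at_top. ?\<xi> x \<in> ?D \<and> ?\<xi> x \<noteq> 0"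
      using ev by eventually_elim auto
    have "((\<lambda>x. - \<i> * complex_of_real (1 / x)) \<longlongrightarrow> - \<i> * complex_of_real 0) at_top"
      by (intro tendsto_mult tendsto_const tendsto_of_real) real_asymp
    then show "(?\<xi> \<longlongrightarrow> 0) at_top"
      by (simp add: divide_inverse inverse_mult_distrib)
  qed
  moreover have "((\<lambda>z. z * g z) \<longlongrightarrow> 1) (at 0 within ?D)"
    using g by (simp add: cauchy_right_inverse_def)
  ultimately have "((\<lambda>x. ?\<xi> x * g (?\<xi> x)) \<longlongrightarrow> 1) at_top"
    by (rule filterlim_compose[rotated])
  then show "((\<lambda>x. g (?\<xi> x) / (\<i> * of_real x)) \<longlongrightarrow> 1) at_top"
    by (simp add: divide_inverse mult_ac)
  show "\<forall>\<^sub>F x in at_top. Im (g (?\<xi> x)) > 0 \<and> cauchy_transform \<mu> (g (?\<xi> x)) = ?\<xi> x"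
    using ev by eventually_elim (use g in \<open>auto simp: cauchy_right_inverse_def\<close>)
qed

text \<open>
  A path asymptotic to \<open>i x\<close> goes to infinity nontangentially, so the resolvent kernel, scaled by the
  path, stays bounded uniformly in \<open>t\<close> and tends to \<open>1\<close>.
\<close>

lemma resolvent_asymptotics:
  fixes a :: "real \<Rightarrow> complex"
  assumes a: "((\<lambda>x. a x / (\<i> * of_real x)) \<longlongrightarrow> 1) at_top"
  shows "\<forall>\<^sub>F x in at_top. \<forall>t. norm (a x / (a x - of_real t)) \<le> 2"
    and "((\<lambda>x. a x / (a x - of_real t)) \<longlongrightarrow> 1) at_top"
proof -
  let ?q = "\<lambda>x. a x / (\<i> * of_real x)"
  \<comment> \<open>Then \<open>\<bar>a x\<bar> \<le> 5x/4\<close> while \<open>Im (a x) \<ge> 3x/4\<close>, and the quotient of these bounds is below \<open>2\<close>.\<close>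
  have "\<forall>\<^sub>F x in at_top. dist (?q x) 1 < 1 / 4"
    using a by (rule tendstoD) simp
  then show "\<forall>\<^sub>F x in at_top. \<forall>t. norm (a x / (a x - of_real t)) \<le> 2"
    using eventually_gt_at_top[of 0]
  proof eventually_elim
    case (elim x)
    have ax: "a x = \<i> * of_real x * ?q x"
      using elim by simp
    have "\<bar>Re (?q x) - 1\<bar> \<le> norm (?q x - 1)"
      using abs_Re_le_cmod[of "?q x - 1"] by simp
    then have "Re (?q x) \<ge> 3 / 4"
      using elim by (simp add: dist_norm)
    then have im: "Im (a x) \<ge> x * (3 / 4)"
    proof -
      have "Im (\<i> * of_real x * q) = x * Re q" for q
        by simp
      then have "Im (a x) = x * Re (?q x)"
        using ax by metis
      then show ?thesis
        using \<open>Re (?q x) \<ge> 3 / 4\<close> elim by (simp add: mult_left_mono)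
    qed
    have "norm (?q x) \<le> norm (?q x - 1) + 1"
      using norm_triangle_ineq[of "?q x - 1" 1] by simp
    then have "norm (?q x) \<le> 5 / 4"
      using elim by (simp add: dist_norm)
    then have n: "norm (a x) \<le> x * (5 / 4)"
      using elim by (subst ax) (simp add: norm_mult norm_divide field_simps)
    show ?case
    proof
      fix t
      have "x * (3 / 4) \<le> norm (a x - of_real t)"
        using abs_Im_le_norm_diff_real[of "a x" t] im by linarith
      moreover have "x > 0" by fact
      ultimately have "norm (a x) \<le> 2 * norm (a x - of_real t)" "norm (a x - of_real t) > 0"
        using n by linarith+
      then show "norm (a x / (a x - of_real t)) \<le> 2"
        by (simp add: norm_divide divide_le_eq)
    qed
  qed
  have "((\<lambda>x. ?q x / (?q x - (- \<i>) * of_real (t / x))) \<longlongrightarrow> 1 / (1 - (- \<i>) * of_real 0)) at_top"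
    by (intro tendsto_intros a) (real_asymp | simp)+
  then show "((\<lambda>x. a x / (a x - of_real t)) \<longlongrightarrow> 1) at_top"
  proof (rule Lim_transform_eventually[OF tendsto_eq_rhs])
    show "\<forall>\<^sub>F x in at_top. ?q x / (?q x - (- \<i>) * of_real (t / x)) = a x / (a x - of_real t)"
      using eventually_gt_at_top[of 0]
    proof eventually_elim
      case (elim x)
      have "?q x - (- \<i>) * of_real (t / x) = (a x - of_real t) / (\<i> * of_real x)"
        using elim by (simp add: field_simps)
      then show ?case
        using elim by simp
    qed
  qed simp
qed

text \<open>
  By the resolvent identity, \<open>G a - G b = (b - a) \<integral> 1 / ((a - t) (b - t))\<close>, and \<open>a b\<close> times the integral
  tends to \<open>1\<close> by dominated convergence. So the integral cannot vanish far out, and \<open>G a = G b\<close>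
  forces \<open>a = b\<close>.
\<close>

lemma (in real_distribution) cauchy_transform_asymptotically_injective:
  assumes a: "((\<lambda>x. a x / (\<i> * of_real x)) \<longlongrightarrow> 1) at_top"
    and b: "((\<lambda>x. b x / (\<i> * of_real x)) \<longlongrightarrow> 1) at_top"
    and ev: "\<forall>\<^sub>F x in at_top. Im (a x) > 0 \<and> Im (b x) > 0 \<and> cauchy_transform M (a x) = cauchy_transform M (b x)"
  shows "\<forall>\<^sub>F x in at_top. a x = b x"
proof -
  let ?K = "\<lambda>x t. a x / (a x - of_real t) * (b x / (b x - of_real t))"
  have "((\<lambda>x. \<integral>t. ?K x t \<partial>M) \<longlongrightarrow> (\<integral>t. 1 \<partial>M)) at_top"
  proof (rule integral_dominated_convergence_at_top[where w = "\<lambda>_. 4"])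
    show "AE t in M. (((\<lambda>x. ?K x t) \<longlongrightarrow> 1) at_top)"
      using tendsto_mult[OF resolvent_asymptotics(2)[OF a] resolvent_asymptotics(2)[OF b]] by simp
    show "\<forall>\<^sub>F x in at_top. AE t in M. norm (?K x t) \<le> 4"
      using resolvent_asymptotics(1)[OF a] resolvent_asymptotics(1)[OF b]
    proof eventually_elim
      case (elim x)
      have "norm (?K x t) \<le> 2 * 2" for t
        unfolding norm_mult using elim by (intro mult_mono) auto
      then show ?case by simp
    qed
  qed auto
  then have "\<forall>\<^sub>F x in at_top. (\<integral>t. ?K x t \<partial>M) \<noteq> 0"
    by (rule tendsto_imp_eventually_ne) (simp add: prob_space del: space_eq_univ)
  with ev show ?thesis
  proof eventually_elim
    case (elim x)
    show ?case
    proof (rule ccontr)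
      assume ne: "a x \<noteq> b x"
      have im: "Im (a x) > 0" "Im (b x) > 0" using elim by auto
      have "?K x t = a x * b x / (b x - a x) * (1 / (a x - of_real t) - 1 / (b x - of_real t))" for t
      proof -
        have "a x - of_real t \<noteq> 0" "b x - of_real t \<noteq> 0"
          using im by (auto simp: complex_eq_iff)
        then show ?thesis
          using ne by (simp add: divide_simps) 
      qed
      then have "(\<integral>t. ?K x t \<partial>M)
          = a x * b x / (b x - a x) * (\<integral>t. 1 / (a x - of_real t) - 1 / (b x - of_real t) \<partial>M)"
        by (simp only: integral_mult_right_zero)
      also have "(\<integral>t. 1 / (a x - of_real t) - 1 / (b x - of_real t) \<partial>M)
          = cauchy_transform M (a x) - cauchy_transform M (b x)"
        unfolding cauchy_transform_def
        by (rule Bochner_Integration.integral_diff) (intro integrable_cauchy_kernel im)+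
      finally show False
        using elim by simp
    qed
  qed
qed

text \<open>
  The two right inverses are compared only along the imaginary axis, which eventually lies in both
  truncated cones, whatever their apertures.
\<close>

lemma represents_free_cumulant_unique:
  assumes \<nu>: "real_distribution \<nu>"
    and C: "represents_free_cumulant \<nu> C" "C holomorphic_on {z. Im z < 0}"
    and D: "represents_free_cumulant \<nu> D" "D holomorphic_on {z. Im z < 0}"
    and z: "Im z < 0"
  shows "C z = D z"
proof -
  interpret real_distribution \<nu> by fact
  let ?\<xi> = "\<lambda>x. 1 / (\<i> * complex_of_real x)"
  obtain \<eta> M g where g: "\<eta> > 0" "cauchy_right_inverse \<nu> \<eta> M g"
      "\<And>z. 1 / z \<in> truncated_cone \<eta> M \<Longrightarrow> C z = z * g z - 1"
    using C(1) unfolding represents_free_cumulant_def by blast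
  obtain \<eta>' M' h where h: "\<eta>' > 0" "cauchy_right_inverse \<nu> \<eta>' M' h"
      "\<And>z. 1 / z \<in> truncated_cone \<eta>' M' \<Longrightarrow> D z = z * h z - 1"
    using D(1) unfolding represents_free_cumulant_def by blast
  have "\<forall>\<^sub>F x in at_top. g (?\<xi> x) = h (?\<xi> x)"
  proof (rule cauchy_transform_asymptotically_injective)
    show "\<forall>\<^sub>F x in at_top. Im (g (?\<xi> x)) > 0 \<and> Im (h (?\<xi> x)) > 0 \<and>
        cauchy_transform \<nu> (g (?\<xi> x)) = cauchy_transform \<nu> (h (?\<xi> x))"
      using cauchy_right_inverse_imaginary_axis(2)[OF g(2,1)] cauchy_right_inverse_imaginary_axis(2)[OF h(2,1)]
      by eventually_elim auto
  qed (use cauchy_right_inverse_imaginary_axis(1)[OF g(2,1)] cauchy_right_inverse_imaginary_axis(1)[OF h(2,1)] in auto)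
  then have ev: "\<forall>\<^sub>F x in at_top. \<i> * of_real x \<in> {z. Im z > 0} \<and> C (?\<xi> x) - D (?\<xi> x) = 0"
    using eventually_gt_at_top[of M] eventually_gt_at_top[of M'] eventually_gt_at_top[of 0]
  proof eventually_elim
    case (elim x)
    then show ?case
      using g(3)[of "?\<xi> x"] h(3)[of "?\<xi> x"] imaginary_axis_in_truncated_cone[OF g(1), of x M]
        imaginary_axis_in_truncated_cone[OF h(1), of x M'] by simp
  qed
  have "(\<lambda>z. C (1 / z) - D (1 / z)) (1 / z) = 0"
  proof (rule analytic_continuation_imaginary_axis[OF _ _ _ _ ev])
    have "(\<lambda>z. 1 / z) holomorphic_on {z. Im z > 0}"
      by (intro holomorphic_intros) auto
    moreover have "(\<lambda>z. 1 / z) ` {z. Im z > 0} \<subseteq> {z. Im z < 0}"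
      using Im_one_over_pos_iff[of "1 / z" for z] by auto
    ultimately show "(\<lambda>z. C (1 / z) - D (1 / z)) holomorphic_on {z. Im z > 0}"
      using holomorphic_on_compose_gen[of "\<lambda>z. 1 / z" _ C] holomorphic_on_compose_gen[of "\<lambda>z. 1 / z" _ D] C(2) D(2)
      by (intro holomorphic_on_diff) (auto simp: o_def)
    show "1 / z \<in> {z. Im z > 0}"
      using z Im_one_over_pos_iff[of z] by simp
  qed (auto simp: open_halfspace_Im_gt convex_connected convex_halfspace_Im_gt)
  then show ?thesis
    by simp
qed

lemma free_cumulant_eqI:
  assumes "real_distribution \<nu>" "represents_free_cumulant \<nu> C" "C holomorphic_on {z. Im z < 0}" "Im z < 0"
  shows "free_cumulant \<nu> z = C z"
  unfolding free_cumulant_def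
  by (rule the_equality) (use assms represents_free_cumulant_unique in blast)+

lemma represents_free_cumulant_cong:
  assumes "represents_free_cumulant \<nu> C" and eq: "\<And>z. Im z < 0 \<Longrightarrow> C z = D z"
  shows "represents_free_cumulant \<nu> D"
proof -
  obtain \<eta> M g where g: "\<eta> > 0" "M > 0" "cauchy_right_inverse \<nu> \<eta> M g"
      "\<And>z. 1 / z \<in> truncated_cone \<eta> M \<Longrightarrow> C z = z * g z - 1"
    using assms(1) unfolding represents_free_cumulant_def by blast
  moreover have "Im z < 0" if "1 / z \<in> truncated_cone \<eta> M" for z
    using that g(2) Im_one_over_pos_iff[of z] by (auto simp: truncated_cone_def)
  ultimately show ?thesis
    using eq unfolding represents_free_cumulant_def by metis
qed

text \<open>
  Whichever triplet relates \<open>\<nu>\<close> to the Gamma distribution, its free exponent is the same function.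
\<close>

lemma free_gamma_represents:
  assumes "\<alpha> > 0" "free_gamma_distribution \<alpha> \<nu>"
  shows "real_distribution \<nu>"
    and "represents_free_cumulant \<nu> (\<lambda>z. of_real \<alpha> * cauchy_transform (gamma_distribution 1) (1 / z))"
proof -
  obtain a \<rho> \<eta> where trip: "characteristic_triplet (gamma_distribution \<alpha>) a \<rho> \<eta>"
    and free: "free_characteristic_triplet \<nu> a \<rho> \<eta>"
    using assms(2) unfolding free_gamma_distribution_def bercovici_pata_def by blast
  show "real_distribution \<nu>"
    using free by (simp add: free_characteristic_triplet_def)
  have "represents_free_cumulant \<nu> (free_levy_exponent a \<rho> \<eta>)"
    using free unfolding free_characteristic_triplet_def free_levy_exponent_def[abs_def] by simp
  then show "represents_free_cumulant \<nu> (\<lambda>z. of_real \<alpha> * cauchy_transform (gamma_distribution 1) (1 / z))"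
  proof (rule represents_free_cumulant_cong)
    fix z assume "Im z < 0"
    then have "Im (1 / z) > 0"
      by (simp only: Im_one_over_pos_iff)
    from free_levy_exponent_gamma[OF assms(1) trip this]
    show "free_levy_exponent a \<rho> \<eta> z = of_real \<alpha> * cauchy_transform (gamma_distribution 1) (1 / z)"
      by simp
  qed
qed

lemma free_cumulant_free_gamma:
  assumes "\<alpha> > 0" "free_gamma_distribution \<alpha> \<nu>" "Im z > 0"
  shows "free_cumulant \<nu> (1 / z) = of_real \<alpha> * cauchy_transform (gamma_distribution 1) z"
proof -
  interpret G: real_distribution "gamma_distribution 1"
    by (rule real_distribution_gamma) simp
  have hol: "(\<lambda>z. 1 / z) holomorphic_on {z. Im z < 0}"
    by (intro holomorphic_intros) auto
  have "(\<lambda>z. of_real \<alpha> * cauchy_transform (gamma_distribution 1) (1 / z)) holomorphic_on {z. Im z < 0}"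
    using holomorphic_on_compose_gen[OF hol G.cauchy_transform_holomorphic] Im_one_over_pos_iff
    by (intro holomorphic_on_mult holomorphic_on_const) (auto simp: o_def)
  moreover have "Im (1 / z) < 0"
    using Im_one_over_pos_iff[of "1 / z"] assms(3) by simp
  ultimately show ?thesis
    using free_cumulant_eqI[OF free_gamma_represents[OF assms(1,2)]] by simp
qed

section \<open>The function F and the boundary curve\<close>

abbreviation \<mu>\<^sub>1 :: "real measure" where "\<mu>\<^sub>1 \<equiv> gamma_distribution 1"

interpretation mu1: real_distribution \<mu>\<^sub>1
  by (rule real_distribution_gamma) simp

lemma AE_mu1_pos: "AE t in \<mu>\<^sub>1. t > 0"
  unfolding gamma_distribution_Ioi
  by (subst AE_density) (auto split: split_indicator)

lemma integrable_mu1_id: "integrable \<mu>\<^sub>1 (\<lambda>t. t)"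
proof -
  have "set_integrable lborel {0<..} (\<lambda>t. of_real t ^ 1 * exp (- (1 * of_real t)) :: complex)"
    by (rule gamma_laplace_nat_integrable) simp
  then have "set_integrable lborel {0<..} (\<lambda>t. Re (of_real t ^ 1 * exp (- (1 * of_real t))))"
    unfolding set_integrable_def by (drule_tac integrable_Re) (simp add: scaleR_conv_of_real)
  also have "?this \<longleftrightarrow> set_integrable lborel {0<..} (\<lambda>t. (t powr (1 - 1) * exp (- t) / Gamma 1) *\<^sub>R t)"
    by (rule set_integrable_cong) (auto simp: Re_exp)
  finally show ?thesis
    by (subst gamma_distribution_integral(2)) auto
qed

lemma F_fun_mu1: "F_fun z = (\<integral>t. t / (norm (z - of_real t))\<^sup>2 \<partial>\<mu>\<^sub>1)"
proof -
  have "(\<integral>t. t / (norm (z - of_real t))\<^sup>2 \<partial>\<mu>\<^sub>1) =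
      (LBINT t:{0<..}. (t powr (1 - 1) * exp (- t) / Gamma 1) *\<^sub>R (t / (norm (z - of_real t))\<^sup>2))"
    by (rule gamma_distribution_integral) auto
  also have "\<dots> = F_fun z"
    unfolding F_fun_def set_lebesgue_integral_def
    by (rule Bochner_Integration.integral_cong) (auto split: split_indicator)
  finally show ?thesis ..
qed

text \<open>
  The estimates on \<open>F\<close> only use the distance of \<open>z\<close> from the positive half-line. Stating them for a
  lower bound \<open>d\<close> of this distance covers nonreal points and negative real ones at the same time.
\<close>

lemma F_fun_integrable:
  fixes z :: complex
  assumes "d > 0" "\<And>t. t > 0 \<Longrightarrow> d \<le> norm (z - of_real t)"
  shows "integrable \<mu>\<^sub>1 (\<lambda>t. t / (norm (z - of_real t))\<^sup>2)"
proof (rule Bochner_Integration.integrable_bound)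
  show "integrable \<mu>\<^sub>1 (\<lambda>t. t / d\<^sup>2)"
    using integrable_mu1_id by simp
  show "AE t in \<mu>\<^sub>1. norm (t / (norm (z - of_real t))\<^sup>2) \<le> norm (t / d\<^sup>2)"
    using AE_mu1_pos
  proof eventually_elim
    case (elim t)
    then have "d \<le> norm (z - of_real t)" by (rule assms)
    then show ?case
      using elim assms(1) by (auto intro!: divide_left_mono power_mono mult_pos_pos)
  qed
qed auto

lemma F_fun_bound:
  assumes "d > 0" "\<And>t. t > 0 \<Longrightarrow> d \<le> norm (z - of_real t)"
  shows "F_fun z \<le> (\<integral>t. t \<partial>\<mu>\<^sub>1) / d\<^sup>2"
proof -
  have "F_fun z \<le> (\<integral>t. t / d\<^sup>2 \<partial>\<mu>\<^sub>1)"
    unfolding F_fun_mu1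
  proof (rule integral_mono_AE)
    show "integrable \<mu>\<^sub>1 (\<lambda>t. t / d\<^sup>2)"
      using integrable_mu1_id by simp
    show "AE t in \<mu>\<^sub>1. t / (norm (z - of_real t))\<^sup>2 \<le> t / d\<^sup>2"
      using AE_mu1_pos
    proof eventually_elim
      case (elim t)
      then have "d \<le> norm (z - of_real t)" by (rule assms)
      then show ?case
        using elim assms(1) by (auto intro!: divide_left_mono power_mono mult_pos_pos)
    qed
  qed (rule F_fun_integrable[OF assms])
  then show ?thesis by simp
qed

lemma F_fun_strict_mono:
  assumes "d > 0" "\<And>t. t > 0 \<Longrightarrow> d \<le> norm (z - of_real t)"
    and less: "\<And>t. t > 0 \<Longrightarrow> norm (z - of_real t) < norm (w - of_real t)"
  shows "F_fun w < F_fun z"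
  unfolding F_fun_mu1
proof (rule mu1.integral_less_AE_space)
  show "integrable \<mu>\<^sub>1 (\<lambda>t. t / (norm (z - of_real t))\<^sup>2)"
    using assms(1,2) by (rule F_fun_integrable)
  show "integrable \<mu>\<^sub>1 (\<lambda>t. t / (norm (w - of_real t))\<^sup>2)"
    using assms(1) by (rule F_fun_integrable) (use assms(2) less in \<open>meson less_le_trans less_imp_le order_trans\<close>)
  show "AE t in \<mu>\<^sub>1. t / (norm (w - of_real t))\<^sup>2 < t / (norm (z - of_real t))\<^sup>2"
    using AE_mu1_pos
  proof eventually_elim
    case (elim t)
    have "0 < norm (z - of_real t)" "norm (z - of_real t) < norm (w - of_real t)"
      using less[OF elim] assms(1) assms(2)[OF elim] by auto
    then show ?case
      using elim by (intro divide_strict_left_mono power_strict_mono mult_pos_pos zero_less_power) auto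
  qed
  show "emeasure \<mu>\<^sub>1 (space \<mu>\<^sub>1) \<noteq> 0"
    using mu1.emeasure_space_1 by simp
qed

lemma F_fun_continuous_on:
  assumes "d > 0" "\<And>z t. z \<in> S \<Longrightarrow> t > 0 \<Longrightarrow> d \<le> norm (z - of_real t)"
  shows "continuous_on S F_fun"
  unfolding F_fun_mu1[abs_def]
proof (rule continuous_on_lebesgue_integral[where b = "\<lambda>t. t / d\<^sup>2"])
  show "AE t in \<mu>\<^sub>1. continuous_on S (\<lambda>z. t / (norm (z - of_real t))\<^sup>2)"
    using AE_mu1_pos
  proof eventually_elim
    case (elim t)
    show ?case
      using assms(1) assms(2)[OF _ elim]
      by (intro continuous_intros) (force dest: assms(2)[OF _ elim])
  qed
  show "integrable \<mu>\<^sub>1 (\<lambda>t. t / d\<^sup>2)"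
    using integrable_mu1_id by simp
  fix z assume z: "z \<in> S"
  show "AE t in \<mu>\<^sub>1. norm (t / (norm (z - of_real t))\<^sup>2) \<le> t / d\<^sup>2"
    using AE_mu1_pos
  proof eventually_elim
    case (elim t)
    then have "d \<le> norm (z - of_real t)" by (rule assms(2)[OF z])
    then show ?case
      using elim assms(1) by (auto intro!: divide_left_mono power_mono mult_pos_pos)
  qed
qed auto

text \<open>
  On \<open>[x, x + 1]\<close> the density \<open>t exp (- t)\<close> is at least \<open>(t - x) exp (- (x + 1))\<close>, and the resulting
  integral is elementary. Shifting the linear factor to the point \<open>x\<close> keeps the logarithmic divergence
  as \<open>y\<close> tends to \<open>0\<close>, including the case \<open>x = 0\<close> where the density itself vanishes.
\<close>

lemma F_fun_lower_bound:
  assumes x: "x \<ge> 0" and y: "y > 0"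
  shows "exp (- (x + 1)) / 2 * (ln (1 + y\<^sup>2) - ln (y\<^sup>2)) \<le> F_fun (Complex x y)"
proof -
  let ?c = "exp (- (x + 1)) / 2"
  let ?g = "\<lambda>t. ?c * (2 * (t - x) / ((t - x)\<^sup>2 + y\<^sup>2))"
  let ?f = "\<lambda>t. t * exp (- t) / (norm (Complex x y - of_real t))\<^sup>2"
  have n: "(norm (Complex x y - of_real t))\<^sup>2 = (t - x)\<^sup>2 + y\<^sup>2" for t
    by (simp add: cmod_power2 power2_commute)
  have pos: "(t - x)\<^sup>2 + y\<^sup>2 > 0" for t
    using y by (simp add: add_nonneg_pos)
  have cont: "continuous_on {x..x + 1} ?g"
    by (intro continuous_intros) (use pos in \<open>metis less_irrefl\<close>)
  have "(LBINT t. indicator {x..x+1} t *\<^sub>R ?g t) = ?c * ln ((x + 1 - x)\<^sup>2 + y\<^sup>2) - ?c * ln ((x - x)\<^sup>2 + y\<^sup>2)"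
  proof (rule integral_FTC_atLeastAtMost)
    fix t assume "x \<le> t" "t \<le> x + 1"
    show "((\<lambda>t. ?c * ln ((t - x)\<^sup>2 + y\<^sup>2)) has_vector_derivative ?g t) (at t within {x..x + 1})"
    proof -
      have "((\<lambda>t. (t - x)\<^sup>2 + y\<^sup>2) has_real_derivative 2 * (t - x)) (at t within {x..x + 1})"
        by (auto intro!: derivative_eq_intros)
      from DERIV_cmult[OF DERIV_chain2[OF DERIV_ln[OF pos] this], of ?c]
      show ?thesis
        unfolding has_real_derivative_iff_has_vector_derivative[symmetric]
        by (rule DERIV_cong) (simp only: divide_inverse mult_ac)
    qed
  qed (use cont in auto)
  moreover have "(LBINT t. indicator {x..x+1} t *\<^sub>R ?g t) \<le> F_fun (Complex x y)"
    unfolding F_fun_def set_lebesgue_integral_def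
  proof (rule integral_mono)
    show "integrable lborel (\<lambda>t. indicator {x..x+1} t *\<^sub>R ?g t)"
      using borel_integrable_atLeastAtMost'[OF cont] by (simp add: set_integrable_def)
    have "integrable \<mu>\<^sub>1 (\<lambda>t. t / (norm (Complex x y - of_real t))\<^sup>2)"
      using abs_Im_le_norm_diff_real[of "Complex x y"] y by (intro F_fun_integrable[of y]) auto
    then have "set_integrable lborel {0<..} (\<lambda>t. (t powr (1 - 1) * exp (- t) / Gamma 1) *\<^sub>R (t / (norm (Complex x y - of_real t))\<^sup>2))"
      by (subst (asm) gamma_distribution_integral(2)) auto
    also have "?this \<longleftrightarrow> integrable lborel (\<lambda>t. indicator {0..} t *\<^sub>R ?f t)"
      unfolding set_integrable_def
      by (rule Bochner_Integration.integrable_cong) (auto split: split_indicator)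
    finally show "integrable lborel (\<lambda>t. indicator {0..} t *\<^sub>R ?f t)" .
    fix t
    show "indicator {x..x+1} t *\<^sub>R ?g t \<le> indicator {0..} t *\<^sub>R ?f t"
    proof (cases "t \<in> {x..x+1}")
      case True
      have "exp (- (x + 1)) / 2 * (2 * (t - x)) \<le> t * exp (- t)"
      proof -
        have "exp (- (x + 1)) / 2 * (2 * (t - x)) = (t - x) * exp (- (x + 1))"
          by (simp only: times_divide_eq_left times_divide_eq_right) (simp add: mult.commute)
        also have "\<dots> \<le> t * exp (- t)"
          using True x by (intro mult_mono) auto
        finally show ?thesis .
      qed
      from divide_right_mono[OF this less_imp_le[OF pos[of t]]] have "?g t \<le> ?f t"
        unfolding n by (simp only: times_divide_eq_right)
      then show ?thesis
        using True x by simp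
    next
      case False
      have "0 \<le> indicator {0..} t *\<^sub>R ?f t"
        by (auto split: split_indicator)
      with False show ?thesis by simp
    qed
  qed
  ultimately show ?thesis
    by (simp add: right_diff_distrib)
qed

lemma F_fun_large:
  assumes "x \<ge> 0" "\<epsilon> > 0"
  shows "\<exists>y>0. y < \<epsilon> \<and> F_fun (Complex x y) > B"
proof -
  have "filterlim (\<lambda>y::real. exp (- (x + 1)) / 2 * (ln (1 + y\<^sup>2) - ln (y\<^sup>2))) at_top (at_right 0)"
    by real_asymp
  then have "\<forall>\<^sub>F y in at_right 0. B < exp (- (x + 1)) / 2 * (ln (1 + y\<^sup>2) - ln (y\<^sup>2))"
    by (simp add: filterlim_at_top_dense)
  moreover have "\<forall>\<^sub>F y in at_right 0. y \<in> {0<..<\<epsilon>}"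
    using assms(2) by (rule eventually_at_right_real)
  ultimately have "\<forall>\<^sub>F y in at_right 0. 0 < y \<and> y < \<epsilon> \<and> F_fun (Complex x y) > B"
  proof eventually_elim
    case (elim y)
    then show ?case
      using F_fun_lower_bound[OF assms(1), of y] by auto
  qed
  then show ?thesis
    using eventually_happens' trivial_limit_at_right_real by blast
qed

text \<open>
  A distance from the positive half-line beyond which \<open>F\<close> is below \<open>1 / \<alpha>\<close>: there \<open>F\<close> is at most the
  mean of \<open>\<mu>\<^sub>1\<close> divided by the squared distance.
\<close>

definition F_height :: "real \<Rightarrow> real" where
  "F_height \<alpha> = sqrt (\<alpha> * (\<integral>t. t \<partial>\<mu>\<^sub>1)) + 1"

lemma mu1_mean_nonneg: "(\<integral>t. t \<partial>\<mu>\<^sub>1) \<ge> 0"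
  using AE_mu1_pos by (intro integral_nonneg_AE) auto

lemma F_fun_small:
  assumes \<alpha>: "\<alpha> > 0" and d: "d \<ge> F_height \<alpha>" "\<And>t. t > 0 \<Longrightarrow> d \<le> norm (z - of_real t)"
  shows "F_fun z < 1 / \<alpha>"
proof -
  let ?m = "\<integral>t. t \<partial>\<mu>\<^sub>1"
  have r: "sqrt (\<alpha> * ?m) \<ge> 0" "(sqrt (\<alpha> * ?m))\<^sup>2 = \<alpha> * ?m"
    using \<alpha> mu1_mean_nonneg by simp_all
  then have "sqrt (\<alpha> * ?m) < d" "d > 0"
    using d(1) unfolding F_height_def by linarith+
  then have "\<alpha> * ?m < d\<^sup>2"
    using r power_strict_mono[of "sqrt (\<alpha> * ?m)" d 2] by simp
  then have "?m / d\<^sup>2 < 1 / \<alpha>"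
    using \<alpha> \<open>d > 0\<close> by (simp add: field_simps)
  moreover have "F_fun z \<le> ?m / d\<^sup>2"
    using \<open>d > 0\<close> d(2) by (rule F_fun_bound)
  ultimately show ?thesis by simp
qed

lemma F_height_pos: "\<alpha> > 0 \<Longrightarrow> F_height \<alpha> > 0"
  using mu1_mean_nonneg by (auto simp: F_height_def intro: add_nonneg_pos)

lemma Im_part_le_norm_diff_real: "y \<le> norm (Complex x y - of_real t)"
  using abs_Im_le_norm_diff_real[of "Complex x y" t] by simp

lemma norm_neg_diff_real:
  assumes "c > 0" "t > 0"
  shows "norm (- complex_of_real c - of_real t) = c + t"
proof -
  have "- complex_of_real c - of_real t = of_real (- (c + t))"
    by simp
  then show ?thesis
    using assms by (simp only: norm_of_real)
qed

lemma F_fun_vertical_less: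
  assumes "0 < y" "y < y'"
  shows "F_fun (Complex x y') < F_fun (Complex x y)"
proof (rule F_fun_strict_mono[of y])
  show "norm (Complex x y - of_real t) < norm (Complex x y' - of_real t)" for t
    using assms by (simp add: cmod_def power_strict_mono)
qed (use assms Im_part_le_norm_diff_real in auto)

text \<open>
  On the negative axis \<open>F\<close> is continuous and strictly monotone, and it is small far out. It is large
  near \<open>0\<close> because \<open>(c + t)\<^sup>2 \<le> 2 (c\<^sup>2 + t\<^sup>2)\<close> compares \<open>F (- c)\<close> with half of \<open>F (i c)\<close>.
\<close>

lemma c_const_props:
  assumes \<alpha>: "\<alpha> > 0"
  shows "c_const \<alpha> > 0" "F_fun (- of_real (c_const \<alpha>)) = 1 / \<alpha>"
proof -
  let ?\<phi> = "\<lambda>c. F_fun (- complex_of_real c)"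
  have less: "?\<phi> c' < ?\<phi> c" if "0 < c" "c < c'" for c c'
    by (rule F_fun_strict_mono[of c]) (use that in \<open>auto simp: norm_neg_diff_real\<close>)
  obtain c0 where c0: "0 < c0" "c0 < F_height \<alpha>" "F_fun (Complex 0 c0) > 2 / \<alpha>"
    using F_fun_large[of 0 "F_height \<alpha>" "2 / \<alpha>"] F_height_pos[OF \<alpha>] by auto
  have "F_fun (Complex 0 c0) / 2 = (\<integral>t. t / (norm (Complex 0 c0 - of_real t))\<^sup>2 / 2 \<partial>\<mu>\<^sub>1)"
    unfolding F_fun_mu1 by (rule integral_divide_zero[symmetric])
  also have "\<dots> \<le> ?\<phi> c0"
    unfolding F_fun_mu1
  proof (rule integral_mono_AE)
    show "integrable \<mu>\<^sub>1 (\<lambda>t. t / (norm (Complex 0 c0 - of_real t))\<^sup>2 / 2)"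
      using c0 Im_part_le_norm_diff_real by (intro integrable_divide_zero impI F_fun_integrable[of c0]) auto
    show "integrable \<mu>\<^sub>1 (\<lambda>t. t / (norm (- complex_of_real c0 - of_real t))\<^sup>2)"
      using c0 by (intro F_fun_integrable[of c0]) (auto simp: norm_neg_diff_real)
    show "AE t in \<mu>\<^sub>1. t / (norm (Complex 0 c0 - of_real t))\<^sup>2 / 2 \<le> t / (norm (- complex_of_real c0 - of_real t))\<^sup>2"
      using AE_mu1_pos
    proof eventually_elim
      case (elim t)
      have "(c0 + t)\<^sup>2 \<le> (t\<^sup>2 + c0\<^sup>2) * 2"
        using sum_squares_bound[of c0 t] by (simp add: power2_sum)
      moreover have "0 < (c0 + t)\<^sup>2"
        using c0 elim by simp
      ultimately show ?case
        using elim c0 unfolding norm_neg_diff_real[OF c0(1) elim]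
        by (auto simp: cmod_power2 intro!: divide_left_mono mult_pos_pos add_pos_pos)
    qed
  qed
  finally have "F_fun (Complex 0 c0) / 2 \<le> ?\<phi> c0" .
  with c0(3) have "1 / \<alpha> \<le> ?\<phi> c0"
    by (simp add: field_simps)
  moreover have "?\<phi> (F_height \<alpha>) \<le> 1 / \<alpha>"
    using F_fun_small[OF \<alpha> order_refl, of "- of_real (F_height \<alpha>)"] F_height_pos[OF \<alpha>]
    by (simp add: norm_neg_diff_real)
  moreover have "continuous_on {c0..F_height \<alpha>} ?\<phi>"
  proof (rule continuous_on_compose2[of "(\<lambda>c. - complex_of_real c) ` {c0..F_height \<alpha>}" F_fun])
    show "continuous_on ((\<lambda>c. - complex_of_real c) ` {c0..F_height \<alpha>}) F_fun"
      using c0 by (intro F_fun_continuous_on[of c0]) (auto simp: norm_neg_diff_real)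
  qed (auto intro!: continuous_intros)
  ultimately obtain c where c: "c0 \<le> c" "?\<phi> c = 1 / \<alpha>"
    using IVT2'[of ?\<phi> "F_height \<alpha>" "1 / \<alpha>" c0] c0 by auto
  have "\<exists>!c. c > 0 \<and> ?\<phi> c = 1 / \<alpha>"
  proof (rule ex1I[of _ c])
    fix c' assume "c' > 0 \<and> ?\<phi> c' = 1 / \<alpha>"
    then show "c' = c"
      using less[of c c'] less[of c' c] c c0 by (cases c c' rule: linorder_cases) auto
  qed (use c c0 in auto)
  from theI'[OF this] show "c_const \<alpha> > 0" "F_fun (- of_real (c_const \<alpha>)) = 1 / \<alpha>"
    unfolding c_const_def by auto
qed

text \<open>
  \<open>F\<close> decreases strictly along the vertical line through \<open>x\<close>. For \<open>x < 0\<close> it is continuous down to the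
  real axis, where it exceeds \<open>F (- c\<^sub>\<alpha>) = 1 / \<alpha>\<close>; for \<open>x \<ge> 0\<close> it diverges at the axis, so the
  intermediate value theorem has to start at a small positive height.
\<close>

lemma v_fun_props:
  assumes \<alpha>: "\<alpha> > 0" and x: "x > - c_const \<alpha>"
  shows "v_fun \<alpha> x > 0" "F_fun (Complex x (v_fun \<alpha> x)) = 1 / \<alpha>"
proof -
  note c = c_const_props[OF \<alpha>]
  let ?\<phi> = "\<lambda>y. F_fun (Complex x y)"
  have "\<exists>y0\<ge>0. y0 < F_height \<alpha> \<and> ?\<phi> y0 > 1 / \<alpha> \<and> continuous_on {y0..F_height \<alpha>} ?\<phi>"
  proof (cases "x < 0")
    case True
    have "- of_real (- x) = Complex x 0"
      by (simp add: complex_eq_iff)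
    moreover have "F_fun (- of_real (c_const \<alpha>)) < F_fun (- of_real (- x))"
      by (rule F_fun_strict_mono[of "- x"]) (use True x in \<open>auto simp: norm_neg_diff_real simp del: of_real_minus\<close>)
    ultimately have "?\<phi> 0 > 1 / \<alpha>"
      using c by simp
    moreover have "continuous_on {0..F_height \<alpha>} ?\<phi>"
    proof (rule continuous_on_compose2[of "Complex x ` {0..F_height \<alpha>}" F_fun])
      have "- x \<le> norm (Complex x y - of_real t)" if "t > 0" for y t
        using abs_Re_le_cmod[of "Complex x y - of_real t"] that True by simp
      then show "continuous_on (Complex x ` {0..F_height \<alpha>}) F_fun"
        using True by (intro F_fun_continuous_on[of "- x"]) auto
    qed (auto intro!: continuous_intros simp: Complex_eq)
    ultimately show ?thesis
      using F_height_pos[OF \<alpha>] by blast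
  next
    case False
    then obtain y0 where y0: "y0 > 0" "y0 < F_height \<alpha>" "?\<phi> y0 > 1 / \<alpha>"
      using F_fun_large[of x "F_height \<alpha>" "1 / \<alpha>"] F_height_pos[OF \<alpha>] by auto
    moreover have "continuous_on {y0..F_height \<alpha>} ?\<phi>"
    proof (rule continuous_on_compose2[of "Complex x ` {y0..F_height \<alpha>}" F_fun])
      show "continuous_on (Complex x ` {y0..F_height \<alpha>}) F_fun"
        using y0 by (intro F_fun_continuous_on[of y0]) (auto intro: order_trans[OF _ Im_part_le_norm_diff_real])
    qed (auto intro!: continuous_intros simp: Complex_eq)
    ultimately show ?thesis
      by (intro exI[of _ y0]) auto
  qed
  then obtain y0 where y0: "y0 \<ge> 0" "y0 < F_height \<alpha>" "?\<phi> y0 > 1 / \<alpha>" "continuous_on {y0..F_height \<alpha>} ?\<phi>"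
    by blast
  moreover have "?\<phi> (F_height \<alpha>) < 1 / \<alpha>"
    using F_fun_small[OF \<alpha> order_refl] Im_part_le_norm_diff_real by blast
  ultimately obtain y where y: "y0 \<le> y" "?\<phi> y = 1 / \<alpha>"
    using IVT2'[of ?\<phi> "F_height \<alpha>" "1 / \<alpha>" y0] by auto
  then have "y \<noteq> y0"
    using y0 by auto
  then have "y > 0"
    using y y0 by simp
  have "\<exists>!y. y > 0 \<and> ?\<phi> y = 1 / \<alpha>"
  proof (rule ex1I[of _ y])
    fix y' assume "y' > 0 \<and> ?\<phi> y' = 1 / \<alpha>"
    then show "y' = y"
      using F_fun_vertical_less[of y y' x] F_fun_vertical_less[of y' y x] y \<open>y > 0\<close>
      by (cases y y' rule: linorder_cases) auto
  qed (use y \<open>y > 0\<close> in auto)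
  from theI'[OF this] show "v_fun \<alpha> x > 0" "F_fun (Complex x (v_fun \<alpha> x)) = 1 / \<alpha>"
    using x unfolding v_fun_def by auto
qed

lemma G_plus_subset:
  assumes \<alpha>: "\<alpha> > 0" and z: "z \<in> G_plus \<alpha>"
  shows "Im z > 0" "F_fun z < 1 / \<alpha>"
proof -
  note c = c_const_props[OF \<alpha>]
  have v: "Im z > v_fun \<alpha> (Re z)"
    using z by (simp add: G_plus_def)
  have "Im z > 0 \<and> F_fun z < 1 / \<alpha>"
  proof (cases "Re z \<le> - c_const \<alpha>")
    case True
    then have im: "Im z > 0"
      using v by (simp add: v_fun_def)
    have "F_fun z < F_fun (- of_real (c_const \<alpha>))"
    proof (rule F_fun_strict_mono[of "c_const \<alpha>"])
      fix t :: real assume t: "t > 0"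
      have "(c_const \<alpha> + t)\<^sup>2 \<le> (Re z - t)\<^sup>2"
        using True t c by (subst power2_commute) (intro power_mono, auto)
      then have "(c_const \<alpha> + t)\<^sup>2 < (norm (z - of_real t))\<^sup>2"
        using im add_le_less_mono[of "(c_const \<alpha> + t)\<^sup>2" "(Re z - t)\<^sup>2" 0 "(Im z)\<^sup>2"]
        by (simp add: cmod_power2)
      then show "norm (- complex_of_real (c_const \<alpha>) - of_real t) < norm (z - of_real t)"
        unfolding norm_neg_diff_real[OF c(1) t] by (rule power_less_imp_less_base) simp
    qed (use c in \<open>auto simp: norm_neg_diff_real\<close>)
    then show ?thesis
      using im c by simp
  next
    case False
    then have "v_fun \<alpha> (Re z) > 0" "F_fun (Complex (Re z) (v_fun \<alpha> (Re z))) = 1 / \<alpha>"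
      using v_fun_props[OF \<alpha>, of "Re z"] by auto
    then show ?thesis
      using F_fun_vertical_less[OF _ v, of "Re z"] v by simp
  qed
  then show "Im z > 0" "F_fun z < 1 / \<alpha>"
    by auto
qed

section \<open>The Cauchy transform of the free Gamma distribution\<close>

lemma H_fun_holomorphic: "H_fun \<alpha> holomorphic_on {z. Im z > 0}"
  unfolding H_fun_def[abs_def]
  by (intro holomorphic_intros mu1.cauchy_transform_holomorphic)

text \<open>This follows from \<open>Im (z / (z - t)) = - t Im z / \<bar>z - t\<bar>\<^sup>2\<close> for real \<open>t\<close>.\<close>

lemma Im_H_fun:
  assumes z: "Im z > 0"
  shows "Im (H_fun \<alpha> z) = Im z * (1 - \<alpha> * F_fun z)"
proof -
  have int: "integrable \<mu>\<^sub>1 (\<lambda>t. z * (1 / (z - of_real t)))"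
    by (intro integrable_mult_right mu1.integrable_cauchy_kernel z)
  have "Im (z * cauchy_transform \<mu>\<^sub>1 z) = Im (\<integral>t. z * (1 / (z - of_real t)) \<partial>\<mu>\<^sub>1)"
    unfolding cauchy_transform_def by (simp only: integral_mult_right_zero)
  also have "\<dots> = (\<integral>t. Im (z * (1 / (z - of_real t))) \<partial>\<mu>\<^sub>1)"
    using int by (rule integral_Im[symmetric])
  also have "\<dots> = (\<integral>t. - Im z * (t / (norm (z - of_real t))\<^sup>2) \<partial>\<mu>\<^sub>1)"
    by (rule Bochner_Integration.integral_cong)
      (auto simp: Im_divide cmod_power2 algebra_simps diff_divide_distrib)
  also have "\<dots> = - Im z * F_fun z"
    unfolding F_fun_mu1 by (simp only: integral_mult_right_zero)
  finally have "Im (z * cauchy_transform \<mu>\<^sub>1 z) = - Im z * F_fun z" .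
  moreover have "Im (H_fun \<alpha> z) = Im z + \<alpha> * Im (z * cauchy_transform \<mu>\<^sub>1 z)"
    by (simp add: H_fun_def algebra_simps)
  ultimately show ?thesis
    by (simp only: right_diff_distrib mult_1_right mult_minus_left mult_minus_right) (simp add: mult_ac)
qed

definition H_region :: "real \<Rightarrow> complex set" where
  "H_region \<alpha> = {z. Im z > 0 \<and> F_fun z < 1 / \<alpha>}"

lemma H_region_eq:
  assumes "\<alpha> > 0"
  shows "H_region \<alpha> = {z. Im z > 0} \<inter> H_fun \<alpha> -` {w. Im w > 0}"
  using assms by (auto simp: H_region_def Im_H_fun zero_less_mult_iff field_simps)

lemma open_H_region:
  assumes "\<alpha> > 0"
  shows "open (H_region \<alpha>)"
  unfolding H_region_eq[OF assms]
  by (intro continuous_open_preimage holomorphic_on_imp_continuous_on H_fun_holomorphic open_halfspace_Im_gt)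

lemma high_in_H_region:
  assumes "\<alpha> > 0" "Im z \<ge> F_height \<alpha>"
  shows "z \<in> H_region \<alpha>"
  using assms F_height_pos[OF assms(1)] F_fun_small[OF assms] Im_part_le_norm_diff_real[of "Im z" "Re z"]
  by (simp add: H_region_def)

lemma H_region_vertical_segment:
  assumes z: "z \<in> H_region \<alpha>" and K: "K \<ge> 0"
  shows "closed_segment z (z + \<i> * of_real K) \<subseteq> H_region \<alpha>"
proof
  fix w assume "w \<in> closed_segment z (z + \<i> * of_real K)"
  then obtain u where u: "0 \<le> u" "w = (1 - u) *\<^sub>R z + u *\<^sub>R (z + \<i> * of_real K)"
    by (auto simp: in_segment)
  have w: "w = Complex (Re z) (Im z + u * K)"
    unfolding u(2) by (simp add: complex_eq_iff algebra_simps)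
  have "F_fun w \<le> F_fun z"
  proof (cases "u * K = 0")
    case False
    then have "u * K > 0"
      using u K by (auto simp: zero_less_mult_iff)
    then show ?thesis
      using F_fun_vertical_less[of "Im z" "Im z + u * K" "Re z"] z by (simp add: w H_region_def)
  next
    case True
    then have "w = z"
      by (simp add: w complex_eq_iff)
    then show ?thesis by simp
  qed
  moreover have "Im w > 0"
    using z u(1) K by (simp add: w H_region_def add_pos_nonneg)
  ultimately show "w \<in> H_region \<alpha>"
    using z by (simp add: H_region_def)
qed

text \<open>
  Every point can be moved up vertically, without leaving the region, into a half-plane that the
  region contains.
\<close>

lemma connected_H_region:
  assumes \<alpha>: "\<alpha> > 0"
  shows "connected (H_region \<alpha>)"
proof -
  let ?K = "F_height \<alpha>" and ?b = "\<i> * complex_of_real (F_height \<alpha>)"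
  have "connected_component (H_region \<alpha>) z ?b" if z: "z \<in> H_region \<alpha>" for z
  proof -
    have high: "{w. Im w \<ge> ?K} \<subseteq> H_region \<alpha>"
      using high_in_H_region[OF \<alpha>] by auto
    have "connected_component (H_region \<alpha>) z (z + ?b)"
      unfolding connected_component_def
      by (rule exI[of _ "closed_segment z (z + ?b)"])
        (use H_region_vertical_segment[OF z] F_height_pos[OF \<alpha>] in auto)
    moreover have "connected_component (H_region \<alpha>) (z + ?b) ?b"
      unfolding connected_component_def
      by (rule exI[of _ "{w. Im w \<ge> ?K}"])
        (use high z in \<open>auto simp: H_region_def intro!: convex_connected convex_halfspace_Im_ge\<close>)
    ultimately show ?thesis
      by (rule connected_component_trans)
  qed
  then show ?thesis
    unfolding connected_iff_connected_component
    by (meson connected_component_sym connected_component_trans)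
qed

text \<open>
  On the imaginary axis, high up, \<open>H z = z (1 + \<alpha> G\<^sub>\<mu>\<^sub>1 z)\<close> is the right inverse of \<open>G\<^sub>\<nu>\<close> at \<open>1 / z\<close>.
  The identity spreads from there because \<open>H\<close> maps the region into the domain of \<open>G\<^sub>\<nu>\<close>.
\<close>

lemma cauchy_transform_free_gamma_H_fun:
  assumes \<alpha>: "\<alpha> > 0" and \<nu>: "free_gamma_distribution \<alpha> \<nu>" and z: "z \<in> H_region \<alpha>"
  shows "cauchy_transform \<nu> (H_fun \<alpha> z) = 1 / z"
proof -
  interpret real_distribution \<nu>
    using free_gamma_represents(1)[OF \<alpha> \<nu>] .
  let ?f = "\<lambda>z. cauchy_transform \<nu> (H_fun \<alpha> z) - 1 / z"
  obtain \<eta> M g where g: "\<eta> > 0" "cauchy_right_inverse \<nu> \<eta> M g"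
      "\<And>z. 1 / z \<in> truncated_cone \<eta> M \<Longrightarrow>
        of_real \<alpha> * cauchy_transform \<mu>\<^sub>1 (1 / z) = z * g z - 1"
    using free_gamma_represents(2)[OF \<alpha> \<nu>] unfolding represents_free_cumulant_def by blast
  have upper: "H_region \<alpha> \<subseteq> {z. Im z > 0}"
    by (auto simp: H_region_def)
  have "?f z = 0"
  proof (rule analytic_continuation_imaginary_axis[OF _ open_H_region[OF \<alpha>] connected_H_region[OF \<alpha>] z])
    have "(cauchy_transform \<nu> \<circ> H_fun \<alpha>) holomorphic_on H_region \<alpha>"
      using cauchy_transform_holomorphic H_fun_holomorphic holomorphic_on_subset[OF _ upper]
      by (intro holomorphic_on_compose_gen) (auto simp: H_region_eq[OF \<alpha>])
    moreover have "(\<lambda>z. 1 / z) holomorphic_on H_region \<alpha>"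
      by (intro holomorphic_intros) (auto simp: H_region_def)
    ultimately show "?f holomorphic_on H_region \<alpha>"
      unfolding o_def by (rule holomorphic_on_diff)
    show "\<forall>\<^sub>F x in at_top. \<i> * complex_of_real x \<in> H_region \<alpha> \<and> ?f (\<i> * of_real x) = 0"
      using cauchy_right_inverse_imaginary_axis(2)[OF g(2,1)] eventually_gt_at_top[of M]
        eventually_gt_at_top[of 0] eventually_ge_at_top[of "F_height \<alpha>"]
    proof eventually_elim
      case (elim x)
      let ?w = "\<i> * complex_of_real x"
      have "?w \<in> truncated_cone \<eta> M"
        using imaginary_axis_in_truncated_cone[OF g(1)] elim by blast
      then have "of_real \<alpha> * cauchy_transform \<mu>\<^sub>1 ?w = 1 / ?w * g (1 / ?w) - 1"
        using g(3)[of "1 / ?w"] by simp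
      moreover have "H_fun \<alpha> ?w = ?w * (1 + of_real \<alpha> * cauchy_transform \<mu>\<^sub>1 ?w)"
        by (simp add: H_fun_def algebra_simps)
      ultimately have "H_fun \<alpha> ?w = g (1 / ?w)"
        using elim by simp
      then show ?case
        using elim high_in_H_region[OF \<alpha>, of ?w] by simp
    qed
  qed
  then show ?thesis by simp
qed

theorem proposition3p2:
  fixes \<alpha> :: real and \<nu> :: "real measure"
  assumes "\<alpha> > 0"
    and "free_gamma_distribution \<alpha> \<nu>"
  shows "(\<forall>z. Im z > 0 \<longrightarrow>
            free_cumulant \<nu> (1 / z) = of_real \<alpha> * cauchy_transform (gamma_distribution 1) z) \<and>
         (\<forall>z\<in>G_plus \<alpha>. cauchy_transform \<nu> (H_fun \<alpha> z) = 1 / z)"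
proof (intro conjI allI impI ballI)
  show "free_cumulant \<nu> (1 / z) = of_real \<alpha> * cauchy_transform (gamma_distribution 1) z"
    if "Im z > 0" for z
    using free_cumulant_free_gamma[OF assms that] .
  show "cauchy_transform \<nu> (H_fun \<alpha> z) = 1 / z" if "z \<in> G_plus \<alpha>" for z
    using cauchy_transform_free_gamma_H_fun[OF assms] G_plus_subset[OF assms(1) that]
    by (simp add: H_region_def)
qed

end
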